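(* Let $\{X(i): i\in\mathbb{Z}^d\}$ be a Markov random field with finite state space $A$ and strictly positive finite-dimensional marginals, with joint distribution $Q$. Let $\Lambda_1\subset\Lambda_2\subset\cdots$ be sample regions with $|\Lambda_n|/|\bar\Lambda_n|\to 1$. Let $$0<\alpha\le 1,\qquad \kappa>2^{3d}\,e\,\alpha\log(|A|^2+1).$$ Then, simultaneously for all Markov neighborhoods $\Gamma$ with $r(\Gamma)\le\alpha^{1/(2d)}\log^{1/(2d)}|\bar\Lambda_n|$ and all blocks $a(\Gamma,0)\in A^{\Gamma\cup\{0\}}$, $$\left|\frac{N_n(a(\Gamma,0))}{N_n(a(\Gamma))}-Q(a(0)|a(\Gamma))\right|<\sqrt{\frac{\kappa\log N_n(a(\Gamma))}{N_n(a(\Gamma))}}$$ eventually almost surely as $n\to\infty$.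
   Context: Field. $\|i\|$ is the maximum norm on $\mathbb{Z}^d$; $\log$ is natural; $\subset$ is strict inclusion, $\subseteq$ is inclusion. $\{X(i):i\in\mathbb{Z}^d\}$ are random variables with values in a finite set $A$, with joint distribution $Q$; for $\Delta\subseteq\mathbb{Z}^d$, $X(\Delta)=\{X(i):i\in\Delta\}$ and $a(\Delta)=\{a(i)\in A: i\in\Delta\}$ denotes an element of $A^\Delta$ (a "block" if $\Delta$ is finite). It is assumed that $Q(a(\Delta))=\mathrm{Prob}\{X(\Delta)=a(\Delta)\}>0$ for all finite $\Delta$ and $a(\Delta)\in A^\Delta$; $Q(a(\Delta)|a(\Phi))=\mathrm{Prob}\{X(\Delta)=a(\Delta)\mid X(\Phi)=a(\Phi)\}$ for disjoint finite $\Delta,\Phi$. A neighborhood is a finite (possibly empty) set $\Gamma\subset\mathbb{Z}^d$ with $\Gamma=-\Gamma$, $0\notin\Gamma$; its radius is $r(\Gamma)=\max_{i\in\Gamma}\|i\|$ ($r(\emptyset)=0$). $\Delta^i=\{i+j:j\in\Delta\}$. The field is a Markov random field if there is a neighborhood $\Gamma$, called a Markov neighborhood, such that for every $i\in\mathbb{Z}^d$, $Q(a(i)|a(\Delta^i))=Q(a(i)|a(\Gamma^i))$ for all finite $\Delta\supset\Gamma$ with $0\notin\Delta$ and all configurations, where the right-hand conditional probability is translation invariant (it does not depend on $i$ when blocks are identified by translation). $Q$ itself need not be translation invariant. Sampling. $\Lambda_n\subset\mathbb{Z}^d$ are finite regions; the sample $x(\Lambda_n)$ is the restriction of a realization $x$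 of the field to $\Lambda_n$. $\bar\Lambda_n=\{i\in\Lambda_n:\{j\in\mathbb{Z}^d:\|i-j\|\le\log^{1/(2d)}|\Lambda_n|\}\subseteq\Lambda_n\}$. For a neighborhood $\Gamma$ and block $a(\Gamma)\in A^\Gamma$, $N_n(a(\Gamma))=|\{i\in\bar\Lambda_n:\Gamma^i\subseteq\Lambda_n,\ x(\Gamma^i)=a(\Gamma)\}|$; for a block $a(\Gamma,0)\in A^{\Gamma\cup\{0\}}$ (with restrictions $a(\Gamma)$ and $a(0)$), $N_n(a(\Gamma,0))=|\{i\in\bar\Lambda_n:\Gamma^i\subseteq\Lambda_n,\ x(\Gamma^i\cup\{i\})=a(\Gamma,0)\}|$ (blocks identified by translation). "Eventually almost surely as $n\to\infty$" means: with probability 1 there is a threshold $n_0$ (depending on the infinite realization) such that the claim holds for all $n\ge n_0$; "simultaneously" means that $n_0$ does not depend on $\Gamma$ or $a(\Gamma,0)$. Part of the claim is that $N_n(a(\Gamma))>0$ for all these blocks, so that the quotient is defined. *)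

theory Defs
  imports "HOL-Probability.Probability"
begin

text \<open>
  The lattice is \<^typ>\<open>int ^ 'd\<close>, with \<open>d = CARD('d)\<close>, and the finite state space is the
  type \<open>'a::finite\<close>.  A block in $A^\Delta$ is represented by a total function \<open>a\<close> on the
  lattice, of which only the values on \<open>\<Delta>\<close> are used.
\<close>

definition maxnorm :: "int ^ 'd::finite \<Rightarrow> int" where
  "maxnorm i = Max (range (\<lambda>k. \<bar>i $ k\<bar>))"

definition translate :: "(int ^ 'd) set \<Rightarrow> int ^ 'd \<Rightarrow> (int ^ 'd) set" where
  "translate \<Delta> i = (\<lambda>j. i + j) ` \<Delta>"

definition neighborhood :: "(int ^ 'd) set \<Rightarrow> bool" where
  "neighborhood \<Gamma> \<longleftrightarrow> finite \<Gamma> \<and> \<Gamma> = uminus ` \<Gamma> \<and> 0 \<notin> \<Gamma>"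

definition radius :: "(int ^ 'd::finite) set \<Rightarrow> int" where
  "radius \<Gamma> = (if \<Gamma> = {} then 0 else Max (maxnorm ` \<Gamma>))"

definition random_field :: "'w measure \<Rightarrow> (int ^ 'd \<Rightarrow> 'w \<Rightarrow> 'a::finite) \<Rightarrow> bool" where
  "random_field M X \<longleftrightarrow> prob_space M \<and> (\<forall>i. X i \<in> M \<rightarrow>\<^sub>M count_space UNIV)"

definition block_prob ::
    "'w measure \<Rightarrow> (int ^ 'd \<Rightarrow> 'w \<Rightarrow> 'a) \<Rightarrow> (int ^ 'd) set \<Rightarrow> (int ^ 'd \<Rightarrow> 'a) \<Rightarrow> real" where
  "block_prob M X \<Delta> a = \<P>(\<omega> in M. \<forall>j\<in>\<Delta>. X j \<omega> = a j)"

text \<open>\<open>block_cond_prob M X \<Delta> \<Phi> a\<close> is $Q(a(\Delta) | a(\Phi))$.\<close>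

definition block_cond_prob ::
    "'w measure \<Rightarrow> (int ^ 'd \<Rightarrow> 'w \<Rightarrow> 'a) \<Rightarrow> (int ^ 'd) set \<Rightarrow> (int ^ 'd) set \<Rightarrow> (int ^ 'd \<Rightarrow> 'a) \<Rightarrow> real" where
  "block_cond_prob M X \<Delta> \<Phi> a = \<P>(\<omega> in M. \<forall>j\<in>\<Delta>. X j \<omega> = a j \<bar> \<forall>j\<in>\<Phi>. X j \<omega> = a j)"

definition positive_marginals :: "'w measure \<Rightarrow> (int ^ 'd \<Rightarrow> 'w \<Rightarrow> 'a) \<Rightarrow> bool" where
  "positive_marginals M X \<longleftrightarrow> (\<forall>\<Delta> a. finite \<Delta> \<longrightarrow> block_prob M X \<Delta> a > 0)"

text \<open>
  In the last conjunct, \<open>\<lambda>j. a (j - i)\<close> is the configuration \<open>a\<close> moved by \<open>i\<close>: its block on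
  the translate of \<open>\<Gamma>\<close> by \<open>i\<close> is identified with the block of \<open>a\<close> on \<open>\<Gamma>\<close>.
\<close>

definition Markov_neighborhood ::
    "'w measure \<Rightarrow> (int ^ 'd \<Rightarrow> 'w \<Rightarrow> 'a) \<Rightarrow> (int ^ 'd) set \<Rightarrow> bool" where
  "Markov_neighborhood M X \<Gamma> \<longleftrightarrow>
     neighborhood \<Gamma> \<and>
     (\<forall>i \<Delta> a. finite \<Delta> \<and> \<Gamma> \<subset> \<Delta> \<and> 0 \<notin> \<Delta> \<longrightarrow>
        block_cond_prob M X {i} (translate \<Delta> i) a = block_cond_prob M X {i} (translate \<Gamma> i) a) \<and>
     (\<forall>i a. block_cond_prob M X {i} (translate \<Gamma> i) (\<lambda>j. a (j - i)) = block_cond_prob M X {0} \<Gamma> a)"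

definition Markov_random_field :: "'w measure \<Rightarrow> (int ^ 'd \<Rightarrow> 'w \<Rightarrow> 'a::finite) \<Rightarrow> bool" where
  "Markov_random_field M X \<longleftrightarrow> random_field M X \<and> (\<exists>\<Gamma>. Markov_neighborhood M X \<Gamma>)"

text \<open>\<open>core \<Lambda>\<close> is $\bar\Lambda$.\<close>

definition core :: "(int ^ 'd::finite) set \<Rightarrow> (int ^ 'd) set" where
  "core \<Lambda> = {i \<in> \<Lambda>. {j. real_of_int (maxnorm (i - j))
                        \<le> ln (real (card \<Lambda>)) powr (1 / (2 * real CARD('d)))} \<subseteq> \<Lambda>}"

text \<open>
  The counts $N_n(a(\Gamma))$ and $N_n(a(\Gamma,0))$ in the sample \<open>x\<close> on the region \<open>\<Lambda>\<close>; only the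
  values of \<open>x\<close> on \<open>\<Lambda>\<close> are used.
\<close>

definition count_nbhd ::
    "(int ^ 'd::finite) set \<Rightarrow> (int ^ 'd \<Rightarrow> 'a) \<Rightarrow> (int ^ 'd) set \<Rightarrow> (int ^ 'd \<Rightarrow> 'a) \<Rightarrow> nat" where
  "count_nbhd \<Lambda> x \<Gamma> a =
     card {i \<in> core \<Lambda>. translate \<Gamma> i \<subseteq> \<Lambda> \<and> (\<forall>j\<in>\<Gamma>. x (i + j) = a j)}"

definition count_nbhd_site ::
    "(int ^ 'd::finite) set \<Rightarrow> (int ^ 'd \<Rightarrow> 'a) \<Rightarrow> (int ^ 'd) set \<Rightarrow> (int ^ 'd \<Rightarrow> 'a) \<Rightarrow> nat" where
  "count_nbhd_site \<Lambda> x \<Gamma> a =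
     card {i \<in> core \<Lambda>. translate \<Gamma> i \<subseteq> \<Lambda> \<and> (\<forall>j\<in>\<Gamma> \<union> {0}. x (i + j) = a j)}"

end

theory Submission
  imports Defs "HOL-Real_Asymp.Real_Asymp"
begin

text \<open>
The proof is a coding argument. Let $c = |\bar\Lambda_n|$, let $R$ be the largest integer with
$R^{2d} \le \alpha\ln c$ and $B = (2R+1)^d$, so that every neighborhood in question lies in a box
of $B$ sites, and write $N = N_n(a(\Gamma))$. The numerator of the deviation is the sum $S$ of the
innovations $1\{X(\Gamma^i)=a(\Gamma)\}\,(1\{X(i)=a(0)\} - Q(a(0)|a(\Gamma)))$ over the core.

Split the core into the $B$ residue classes modulo $2R+1$. No site of a class is a neighbor of
another one, so the sites of a class can be revealed one at a time after all their neighborhoods.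
By the Markov property the innovations are then bounded martingale differences, and by
Hoeffding's lemma $\exp(\lambda S_k - \lambda^2 N_k/8)$ is a supermartingale along the class $k$
(\<open>expectation_tilt_le\<close>). The maximal inequality \<open>prob_deviation_event_le\<close> bounds by $e^{-L}$ the
probability that $\lambda S_k - \lambda^2 N_k/8$ ever reaches $L$.

A maximal inequality is needed because the number $B$ of classes is of order $\sqrt{\ln c}$ and the
bound $BL$ below has to be of order $\ln c$. So $L$ can only be of order $\sqrt{\ln c}$; this
suffices for a union over the $\exp(O(\sqrt{\ln c}))$ neighborhoods and blocks, but $e^{-L}$ is not
summable over $n$. All $n$ for which the core radius has the same integer part $\rho$ are treated
together; in such a phase the core grows with $n$. With $L$ the logarithm of the number of tests
times $(\rho+1)^3$, the Borel--Cantelli lemma over $\rho$ applies. Adding the bounds over the $B$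
classes and taking $\lambda$ adapted to the dyadic scale of $N$ gives $S^2 \le BLN$
(\<open>count_deviation_square_le\<close>). As $L$ is $B\ln(|A|^2+1)$ up to lower order terms and
$B^2 \sim 4^d\alpha\ln c$, the hypothesis on $\kappa$ yields $BL \le (\kappa/4)\ln c$ eventually
(\<open>eventually_threshold_le\<close>).

It remains to compare $\ln c$ with $\ln N$. Every symbol has conditional probability at least some
$q > 0$ at every site, so a block of $B$ sites appears with conditional probability at
least $q^B = c^{-o(1)}$ in each of the disjoint boxes of one residue class, whatever happens in the
others. Chernoff's inequality gives $N \ge \sqrt c$ for all blocks, with failure probabilities
summable over $n$ (\<open>AE_eventually_many_occurrences\<close>). So $\ln N \ge \frac12\ln c$ and
$S^2 \le (\kappa/2) N\ln N < \kappa N\ln N$.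
\<close>

section \<open>Functions of finitely many sites\<close>

text \<open>
Everything the sample shows at finite range is a function of the configuration that depends on
finitely many sites. For such a function measurability, integrability and the expectation
reduce to a finite sum over blocks.
\<close>
definition depends_on :: "'i set \<Rightarrow> (('i \<Rightarrow> 'a) \<Rightarrow> 'b) \<Rightarrow> bool" where
  "depends_on D h \<longleftrightarrow> (\<forall>x y. (\<forall>j\<in>D. x j = y j) \<longrightarrow> h x = h y)"

lemma depends_onI: "(\<And>x y. (\<And>j. j \<in> D \<Longrightarrow> x j = y j) \<Longrightarrow> h x = h y) \<Longrightarrow> depends_on D h"
  unfolding depends_on_def by blast

lemma depends_onD: "depends_on D h \<Longrightarrow> (\<And>j. j \<in> D \<Longrightarrow> x j = y j) \<Longrightarrow> h x = h y"
  unfolding depends_on_def by blast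

lemma depends_on_mono: "depends_on D h \<Longrightarrow> D \<subseteq> E \<Longrightarrow> depends_on E h"
  unfolding depends_on_def by blast

lemma depends_on_restrict: "depends_on D h \<Longrightarrow> h (restrict x D) = h x"
  by (erule depends_onD) auto

lemma depends_on_prod:
  fixes g :: "'k \<Rightarrow> ('i \<Rightarrow> 'a) \<Rightarrow> real"
  shows "(\<And>i. i \<in> I \<Longrightarrow> depends_on D (g i)) \<Longrightarrow> depends_on D (\<lambda>x. \<Prod>i\<in>I. g i x)"
  unfolding depends_on_def by (auto intro!: prod.cong)

lemma depends_on_compose: "depends_on D h \<Longrightarrow> depends_on D (\<lambda>x. f (h x))"
  unfolding depends_on_def by metis

lemma depends_on_compose2:
  "depends_on D h \<Longrightarrow> depends_on D g \<Longrightarrow> depends_on D (\<lambda>x. f (h x) (g x))"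
  unfolding depends_on_def by metis

lemmas depends_on_mult = depends_on_compose2[where f = "(*)"]

locale finite_valued_field = prob_space M
  for M :: "'w measure" +
  fixes X :: "int ^ 'd::finite \<Rightarrow> 'w \<Rightarrow> 'a::finite"
  assumes X_measurable [measurable]: "X i \<in> M \<rightarrow>\<^sub>M count_space UNIV"
begin

abbreviation conf :: "'w \<Rightarrow> int ^ 'd \<Rightarrow> 'a" where
  "conf \<omega> \<equiv> (\<lambda>i. X i \<omega>)"

lemma block_event [measurable]:
  "finite D \<Longrightarrow> {\<omega> \<in> space M. \<forall>j\<in>D. X j \<omega> = b j} \<in> sets M"
  by measurable

text \<open>
A function of the block on $D$ is constant on each of the finitely many block events, so it is
the corresponding combination of their indicators.
\<close>
lemma local_fun_eq_sum:
  fixes h :: "(int ^ 'd \<Rightarrow> 'a) \<Rightarrow> real"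
  assumes "finite D" "depends_on D h" "\<omega> \<in> space M"
  shows "h (conf \<omega>) =
    (\<Sum>b\<in>D \<rightarrow>\<^sub>E UNIV. h b * indicator {\<omega> \<in> space M. \<forall>j\<in>D. X j \<omega> = b j} \<omega>)"
proof -
  let ?r = "restrict (conf \<omega>) D"
  have "(\<Sum>b\<in>D \<rightarrow>\<^sub>E UNIV. h b * indicator {\<omega> \<in> space M. \<forall>j\<in>D. X j \<omega> = b j} \<omega>)
      = (\<Sum>b\<in>D \<rightarrow>\<^sub>E UNIV. if b = ?r then h b else 0)"
  proof (intro sum.cong refl)
    fix b :: "int ^ 'd \<Rightarrow> 'a" assume b: "b \<in> D \<rightarrow>\<^sub>E UNIV"
    have "(\<forall>j\<in>D. X j \<omega> = b j) \<longleftrightarrow> b = ?r"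
      using b by (auto simp: fun_eq_iff PiE_def extensional_def restrict_def)
    then show "h b * indicator {\<omega> \<in> space M. \<forall>j\<in>D. X j \<omega> = b j} \<omega> = (if b = ?r then h b else 0)"
      using assms by (auto simp: indicator_def)
  qed
  also have "\<dots> = h ?r"
    using assms(1) by (subst sum.delta) (auto intro!: finite_PiE)
  also have "\<dots> = h (conf \<omega>)"
    using assms(2) by (rule depends_on_restrict)
  finally show ?thesis by simp
qed

lemma integrable_local_fun:
  fixes h :: "(int ^ 'd \<Rightarrow> 'a) \<Rightarrow> real"
  assumes "finite D" "depends_on D h"
  shows "integrable M (\<lambda>\<omega>. h (conf \<omega>))"
proof (subst Bochner_Integration.integrable_cong[OF refl local_fun_eq_sum[OF assms]])
  show "integrable M (\<lambda>\<omega>. \<Sum>b\<in>D \<rightarrow>\<^sub>E UNIV. h b * indicator {\<omega> \<in> space M. \<forall>j\<in>D. X j \<omega> = b j} \<omega>)"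
    using assms(1) by (intro Bochner_Integration.integrable_sum integrable_mult_right integrable_real_indicator)
      (auto simp: emeasure_eq_measure)
qed auto

lemma expectation_local_fun:
  fixes h :: "(int ^ 'd \<Rightarrow> 'a) \<Rightarrow> real"
  assumes "finite D" "depends_on D h"
  shows "expectation (\<lambda>\<omega>. h (conf \<omega>)) = (\<Sum>b\<in>D \<rightarrow>\<^sub>E UNIV. h b * block_prob M X D b)"
proof -
  have "expectation (\<lambda>\<omega>. h (conf \<omega>)) = expectation
      (\<lambda>\<omega>. \<Sum>b\<in>D \<rightarrow>\<^sub>E UNIV. h b * indicator {\<omega> \<in> space M. \<forall>j\<in>D. X j \<omega> = b j} \<omega>)"
    by (intro Bochner_Integration.integral_cong refl local_fun_eq_sum assms)
  also have "\<dots> = (\<Sum>b\<in>D \<rightarrow>\<^sub>E UNIV. h b * block_prob M X D b)"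
    using assms(1)
    by (subst Bochner_Integration.integral_sum)
       (auto simp: block_prob_def emeasure_eq_measure Int_def conj_commute cong: conj_cong
             intro!: integrable_real_indicator sum.cong integrable_mult_right)
  finally show ?thesis .
qed

lemma local_fun_measurable [measurable (raw)]:
  fixes h :: "(int ^ 'd \<Rightarrow> 'a) \<Rightarrow> real"
  assumes "finite D" "depends_on D h"
  shows "(\<lambda>\<omega>. h (conf \<omega>)) \<in> borel_measurable M"
  using integrable_local_fun[OF assms] by auto

lemma local_event:
  assumes "finite D" "depends_on D P"
  shows "{\<omega> \<in> space M. P (conf \<omega>)} \<in> sets M"
proof -
  have "depends_on D (\<lambda>x. of_bool (P x) :: real)"
    using assms(2) by (auto simp: depends_on_def)
  from local_fun_measurable[OF assms(1) this]
  have "{\<omega> \<in> space M. (of_bool (P (conf \<omega>)) :: real) > 0} \<in> sets M"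
    by measurable
  moreover have "(of_bool Q :: real) > 0 \<longleftrightarrow> Q" for Q
    by simp
  ultimately show ?thesis by (simp only:)
qed

lemma block_prob_cong: "(\<And>j. j \<in> D \<Longrightarrow> b j = b' j) \<Longrightarrow> block_prob M X D b = block_prob M X D b'"
  unfolding block_prob_def by (intro arg_cong[where f = "measure M"]) auto

lemma block_cond_prob_eq:
  "block_cond_prob M X {i} D b = block_prob M X (insert i D) b / block_prob M X D b"
  unfolding block_cond_prob_def block_prob_def cond_prob_def by simp

lemma block_cond_prob_cong:
  "(\<And>j. j \<in> insert i D \<Longrightarrow> b j = b' j) \<Longrightarrow>
    block_cond_prob M X {i} D b = block_cond_prob M X {i} D b'"
  unfolding block_cond_prob_eq by (intro arg_cong2[where f = "(/)"] block_prob_cong) auto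

lemma sum_block_prob_insert:
  assumes "finite D" "i \<notin> D"
  shows "(\<Sum>s\<in>UNIV. block_prob M X (insert i D) (b(i := s))) = block_prob M X D b"
proof -
  have eq: "{\<omega>\<in>space M. \<forall>j\<in>insert i D. X j \<omega> = (b(i := s)) j}
      = {\<omega>\<in>space M. (\<forall>j\<in>D. X j \<omega> = b j) \<and> X i \<omega> = s}" for s
    using assms(2) by auto
  have "(\<Sum>s\<in>UNIV. block_prob M X (insert i D) (b(i := s)))
      = prob (\<Union>s. {\<omega>\<in>space M. (\<forall>j\<in>D. X j \<omega> = b j) \<and> X i \<omega> = s})"
    unfolding block_prob_def eq using assms(1)
    by (intro finite_measure_finite_Union[symmetric]) (auto simp: disjoint_family_on_def)
  also have "(\<Union>s. {\<omega>\<in>space M. (\<forall>j\<in>D. X j \<omega> = b j) \<and> X i \<omega> = s})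
      = {\<omega>\<in>space M. \<forall>j\<in>D. X j \<omega> = b j}"
    by auto
  finally show ?thesis by (simp add: block_prob_def)
qed

text \<open>
This is the tower property in the only form used below: conditionally on the block on \<open>D\<close>, the
factor \<open>g\<close> that looks at one more site has mean at most \<open>r\<close>, and a weight \<open>h\<close> that is a function
of that block can be pulled out. The condition \<open>le\<close> is the bound on the conditional mean,
multiplied by the probability of the block, which avoids dividing by it. Since \<open>g\<close> and \<open>r\<close> may be
negative, the rule also yields lower bounds.
\<close>
lemma expectation_insert_site_le:
  fixes h g :: "(int ^ 'd \<Rightarrow> 'a) \<Rightarrow> real"
  assumes D: "finite D" "i \<notin> D"
    and h: "depends_on D h" "\<And>x. 0 \<le> h x"
    and g: "depends_on (insert i D) g"
    and le: "\<And>b. (\<Sum>s\<in>UNIV. g (b(i := s)) * block_prob M X (insert i D) (b(i := s)))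
                 \<le> r * block_prob M X D b"
  shows "expectation (\<lambda>\<omega>. h (conf \<omega>) * g (conf \<omega>)) \<le> r * expectation (\<lambda>\<omega>. h (conf \<omega>))"
proof -
  let ?p = "block_prob M X (insert i D)"
  have hg: "depends_on (insert i D) (\<lambda>x. h x * g x)"
    using depends_on_mono[OF h(1), of "insert i D"] g by (intro depends_on_mult) auto
  have "expectation (\<lambda>\<omega>. h (conf \<omega>) * g (conf \<omega>))
      = (\<Sum>b\<in>insert i D \<rightarrow>\<^sub>E UNIV. h b * g b * ?p b)"
    using D(1) hg by (subst expectation_local_fun[of "insert i D"]) auto
  also have "\<dots> = (\<Sum>(s, b)\<in>UNIV \<times> (D \<rightarrow>\<^sub>E UNIV). h (b(i := s)) * g (b(i := s)) * ?p (b(i := s)))"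
    unfolding PiE_insert_eq using inj_combinator[OF D(2), of "\<lambda>_. UNIV :: 'a set"]
    by (subst sum.reindex) (auto simp: case_prod_beta cong: sum.cong)
  also have "\<dots> = (\<Sum>b\<in>D \<rightarrow>\<^sub>E UNIV. \<Sum>s\<in>UNIV. h b * (g (b(i := s)) * ?p (b(i := s))))"
  proof -
    have "h (b(i := s)) = h b" for b s
      using D(2) by (intro depends_onD[OF h(1)]) auto
    then show ?thesis
      by (simp add: sum.cartesian_product[symmetric] mult.assoc) (rule sum.swap)
  qed
  also have "\<dots> \<le> (\<Sum>b\<in>D \<rightarrow>\<^sub>E UNIV. h b * (r * block_prob M X D b))"
    unfolding sum_distrib_left[symmetric] by (intro sum_mono mult_left_mono le h)
  also have "\<dots> = r * expectation (\<lambda>\<omega>. h (conf \<omega>))"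
    by (subst expectation_local_fun[OF D(1) h(1)]) (simp add: sum_distrib_left mult_ac)
  finally show ?thesis .
qed

text \<open>
Factors are revealed one after the other. Here \<open>N i\<close> is the set of sites that \<open>g i\<close> looks at and
\<open>B i\<close> the part of them that is still fresh when \<open>g i\<close> is revealed; as \<open>B i\<close> misses \<open>D\<close> and all
other \<open>N j\<close>, the one-step bound \<open>step\<close> applies to each factor whatever the order. The
rule is used with \<open>B i = {i}\<close> for exponential supermartingales and with \<open>B i = N i\<close>
for occurrences of a block in disjoint windows.
\<close>
lemma expectation_prod_sites_le:
  fixes h :: "(int ^ 'd \<Rightarrow> 'a) \<Rightarrow> real"
  assumes "finite I" "finite D" "depends_on D h" "\<And>x. 0 \<le> h x"
    and "\<And>i. i \<in> I \<Longrightarrow> finite (N i) \<and> depends_on (N i) (g i)" "\<And>i x. i \<in> I \<Longrightarrow> 0 \<le> g i x"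
    and disj: "\<And>i j. i \<in> I \<Longrightarrow> j \<in> I \<Longrightarrow> i \<noteq> j \<Longrightarrow> B i \<inter> N j = {}" 
    and "\<And>i. i \<in> I \<Longrightarrow> B i \<inter> D = {}"
    and step: "\<And>i E k. i \<in> I \<Longrightarrow> finite E \<Longrightarrow> B i \<inter> E = {} \<Longrightarrow> D \<subseteq> E \<Longrightarrow>
       depends_on E k \<Longrightarrow> (\<And>x. 0 \<le> k x) \<Longrightarrow>
       expectation (\<lambda>\<omega>. k (conf \<omega>) * g i (conf \<omega>)) \<le> r * expectation (\<lambda>\<omega>. k (conf \<omega>))"
    and r: "0 \<le> r"
  shows "expectation (\<lambda>\<omega>. h (conf \<omega>) * (\<Prod>i\<in>I. g i (conf \<omega>)))
       \<le> r ^ card I * expectation (\<lambda>\<omega>. h (conf \<omega>))"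
  using assms(1,5-9)
proof (induction I rule: finite_induct)
  case (insert i I)
  let ?E = "D \<union> (\<Union>j\<in>I. N j)"
  have dep: "depends_on ?E (\<lambda>x. h x * (\<Prod>i\<in>I. g i x))"
    using depends_on_mono[OF assms(3), of ?E] insert.prems(1)
    by (intro depends_on_mult depends_on_prod) (auto intro: depends_on_mono)
  have "B i \<inter> N j = {}" if "j \<in> I" for j
    using insert.prems(3)[of i j] insert.hyps that by auto
  then have away: "B i \<inter> ?E = {}"
    using insert.prems(4)[of i] by blast
  have "expectation (\<lambda>\<omega>. h (conf \<omega>) * (\<Prod>i\<in>insert i I. g i (conf \<omega>)))
      = expectation (\<lambda>\<omega>. (h (conf \<omega>) * (\<Prod>i\<in>I. g i (conf \<omega>))) * g i (conf \<omega>))"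
    using insert.hyps by (simp add: mult_ac)
  also have "\<dots> \<le> r * expectation (\<lambda>\<omega>. h (conf \<omega>) * (\<Prod>i\<in>I. g i (conf \<omega>)))"
    using insert.prems(1,2) insert.hyps(1) assms(2,4) dep away
    by (intro insert.prems(5)[of i ?E]) (auto intro!: mult_nonneg_nonneg prod_nonneg)
  also have "\<dots> \<le> r * (r ^ card I * expectation (\<lambda>\<omega>. h (conf \<omega>)))"
    using insert.prems by (intro mult_left_mono insert.IH r) auto
  also have "\<dots> = r ^ card (insert i I) * expectation (\<lambda>\<omega>. h (conf \<omega>))"
    using insert.hyps by simp
  finally show ?case .
qed simp

end


section \<open>A maximal inequality for products of one-site factors\<close>

text \<open>
Hoeffding's lemma for a centred Bernoulli variable. For negative \<open>l\<close> the roles of success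
and failure are exchanged.
\<close>
lemma bernoulli_mgf_le:
  fixes p l :: real
  assumes "0 \<le> p" "p \<le> 1"
  shows "p * exp (l * (1 - p)) + (1 - p) * exp (- l * p) \<le> exp (l\<^sup>2 / 8)"
proof -
  have pos: "p * exp (h * (1 - p)) + (1 - p) * exp (- h * p) \<le> exp (h\<^sup>2 / 8)"
    if "0 \<le> h" "0 \<le> p" "p \<le> 1" for h p :: real
  proof -
    have 1: "1 + p * (exp h - 1) > 0"
      using that by (intro add_pos_nonneg mult_nonneg_nonneg) auto
    have "p * exp (h * (1 - p)) + (1 - p) * exp (- h * p)
        = exp (- h * p) * (1 + p * (exp h - 1))"
      by (simp add: algebra_simps flip: exp_add)
    also have "\<dots> = exp (- h * p + ln (1 + p * (exp h - 1)))"
      using 1 by (simp add: exp_diff exp_minus field_simps)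
    also have "\<dots> \<le> exp (h\<^sup>2 / 8)"
      using Hoeffdings_lemma_aux[OF that(1,2)] by simp
    finally show ?thesis .
  qed
  show ?thesis
  proof (cases "0 \<le> l")
    case True
    then show ?thesis using pos assms by blast
  next
    case False
    then show ?thesis using pos[of "- l" "1 - p"] assms by (simp add: algebra_simps)
  qed
qed

text \<open>
The products over the growing sets \<open>F t\<close>, frozen at the first time at which they reach the level
\<open>c\<close>. If each new factor has conditional mean at most 1 this is a stopped nonnegative
supermartingale, and it ends above \<open>c\<close> exactly when some product reached \<open>c\<close>.
\<close>
primrec stopped_prod ::
    "real \<Rightarrow> ('i \<Rightarrow> 'c \<Rightarrow> real) \<Rightarrow> (nat \<Rightarrow> 'i set) \<Rightarrow> nat \<Rightarrow> 'c \<Rightarrow> real" where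
  "stopped_prod c g F 0 x = (\<Prod>i\<in>F 0. g i x)"
| "stopped_prod c g F (Suc t) x =
     (if c \<le> stopped_prod c g F t x then stopped_prod c g F t x
      else stopped_prod c g F t x * (\<Prod>i\<in>F (Suc t) - F t. g i x))"

lemma stopped_prod_not_stopped:
  assumes "incseq F" "\<And>t. finite (F t)" "stopped_prod c g F t x < c"
  shows "stopped_prod c g F t x = (\<Prod>i\<in>F t. g i x) \<and> (\<forall>s\<le>t. (\<Prod>i\<in>F s. g i x) < c)"
  using assms(3)
proof (induction t)
  case (Suc t)
  have less: "stopped_prod c g F t x < c"
    using Suc.prems by (auto split: if_splits)
  have sub: "F t \<subseteq> F (Suc t)"
    using assms(1) by (auto simp: incseq_Suc_iff)
  have "stopped_prod c g F (Suc t) x = (\<Prod>i\<in>F t. g i x) * (\<Prod>i\<in>F (Suc t) - F t. g i x)"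
    using less Suc.IH[OF less] by (metis not_le stopped_prod.simps(2))
  also have "\<dots> = (\<Prod>i\<in>F (Suc t). g i x)"
    using prod.subset_diff[OF sub assms(2), of "\<lambda>i. g i x"] by (simp add: mult.commute)
  finally have "stopped_prod c g F (Suc t) x = (\<Prod>i\<in>F (Suc t). g i x)" .
  then show ?case
    using Suc.prems Suc.IH[OF less] by (auto simp: le_Suc_eq)
qed auto

lemma stopped_prod_nonneg: "(\<And>i. 0 \<le> g i x) \<Longrightarrow> 0 \<le> stopped_prod c g F t x"
  by (induction t) (auto intro!: prod_nonneg mult_nonneg_nonneg)

lemma depends_on_stopped_prod:
  assumes "incseq F" "\<And>i. i \<in> F t \<Longrightarrow> depends_on (insert i D) (g i)"
  shows "depends_on (D \<union> F t) (stopped_prod c g F t)"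
  using assms(2)
proof (induction t)
  case 0
  have "depends_on (D \<union> F 0) (\<lambda>x. \<Prod>i\<in>F 0. g i x)"
    by (rule depends_on_prod, rule depends_on_mono[OF "0.prems"]) auto
  then show ?case by (simp add: depends_on_def)
next
  case (Suc t)
  have sub: "F t \<subseteq> F (Suc t)"
    using assms(1) by (auto simp: incseq_Suc_iff)
  have "depends_on (D \<union> F t) (stopped_prod c g F t)"
    using sub by (intro Suc.IH Suc.prems) auto
  then have "depends_on (D \<union> F (Suc t)) (stopped_prod c g F t)"
    by (rule depends_on_mono) (use sub in auto)
  moreover have "depends_on (D \<union> F (Suc t)) (\<lambda>x. \<Prod>i\<in>F (Suc t) - F t. g i x)"
    by (rule depends_on_prod, rule depends_on_mono[OF Suc.prems]) auto
  ultimately show ?case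
    using depends_on_compose2[where f = "\<lambda>v w. if c \<le> v then v else v * w"] by fastforce
qed

context finite_valued_field
begin

text \<open>
On the event that the product has not been stopped, which is decided by the sites in
\<open>D \<union> F t\<close>, the step to time \<open>Suc t\<close> multiplies by factors with conditional mean at most 1; on
the complement nothing changes.
\<close>
lemma expectation_stopped_prod_le:
  assumes F: "incseq F" "\<And>t. finite (F t)" and D: "finite D" "D \<inter> F m = {}"
    and g: "\<And>i x. 0 \<le> g i x" "\<And>i. i \<in> F m \<Longrightarrow> depends_on (insert i D) (g i)"
    and step: "\<And>i E k. i \<in> F m \<Longrightarrow> finite E \<Longrightarrow> D \<subseteq> E \<Longrightarrow> i \<notin> E \<Longrightarrow>
       depends_on E k \<Longrightarrow> (\<And>x. 0 \<le> k x) \<Longrightarrow>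
       expectation (\<lambda>\<omega>. k (conf \<omega>) * g i (conf \<omega>)) \<le> expectation (\<lambda>\<omega>. k (conf \<omega>))"
    and t: "t \<le> m"
  shows "expectation (\<lambda>\<omega>. stopped_prod c g F t (conf \<omega>)) \<le> 1"
  using t
proof (induction t)
  case 0
  have sub: "F 0 \<subseteq> F m"
    using F(1) by (auto simp: incseq_def)
  have "expectation (\<lambda>\<omega>. 1 * (\<Prod>i\<in>F 0. g i (conf \<omega>)))
      \<le> 1 ^ card (F 0) * expectation (\<lambda>\<omega>. 1)"
    by (rule expectation_prod_sites_le[where D = D and B = "\<lambda>i. {i}" and N = "\<lambda>i. insert i D"])
       (use sub F D g step in \<open>auto simp: depends_on_def\<close>)
  then show ?case by (simp add: prob_space)
next
  case (Suc t)
  let ?V = "stopped_prod c g F t"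
  let ?\<Pi> = "\<lambda>x. \<Prod>i\<in>F (Suc t) - F t. g i x"
  \<comment> \<open>The part of the product that is still running, and the part that has been stopped.\<close>
  let ?k = "\<lambda>x. ?V x * of_bool (?V x < c)"
  let ?l = "\<lambda>x. ?V x * of_bool (c \<le> ?V x)"
  have sub: "F t \<subseteq> F (Suc t)" "F (Suc t) \<subseteq> F m" "F t \<subseteq> F m"
    using F(1) Suc.prems by (auto simp: incseq_def)
  have V: "depends_on (D \<union> F t) ?V"
    using sub g(2) by (intro depends_on_stopped_prod F(1)) auto
  have k: "depends_on (D \<union> F t) ?k" and l: "depends_on (D \<union> F t) ?l"
    using depends_on_compose[OF V, of "\<lambda>v. v * of_bool (v < c)"]
      depends_on_compose[OF V, of "\<lambda>v. v * of_bool (c \<le> v)"] by auto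
  have \<Pi>: "depends_on (D \<union> F (Suc t)) ?\<Pi>"
    by (rule depends_on_prod, rule depends_on_mono[of "insert i D" for i]) (use sub g(2) in auto)
  have fin: "finite (D \<union> F t)" "finite (D \<union> F (Suc t))"
    using D(1) F(2) by auto
  have nonneg: "0 \<le> ?V x" for x
    by (intro stopped_prod_nonneg g)
  have int: "integrable M (\<lambda>\<omega>. ?k (conf \<omega>))" "integrable M (\<lambda>\<omega>. ?l (conf \<omega>))"
      "integrable M (\<lambda>\<omega>. ?k (conf \<omega>) * ?\<Pi> (conf \<omega>))"
  proof -
    show "integrable M (\<lambda>\<omega>. ?k (conf \<omega>))" "integrable M (\<lambda>\<omega>. ?l (conf \<omega>))"
      by (rule integrable_local_fun[OF fin(1)], rule k l)+
    have "depends_on (D \<union> F (Suc t)) (\<lambda>x. ?k x * ?\<Pi> x)"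
      by (intro depends_on_mult \<Pi> depends_on_mono[OF k]) (use sub in auto)
    then show "integrable M (\<lambda>\<omega>. ?k (conf \<omega>) * ?\<Pi> (conf \<omega>))"
      by (rule integrable_local_fun[OF fin(2)])
  qed
  have "expectation (\<lambda>\<omega>. ?k (conf \<omega>) * ?\<Pi> (conf \<omega>))
      \<le> 1 ^ card (F (Suc t) - F t) * expectation (\<lambda>\<omega>. ?k (conf \<omega>))"
  proof (rule expectation_prod_sites_le[OF _ fin(1) k, where B = "\<lambda>i. {i}"
        and N = "\<lambda>i. insert i D"])
    fix i E and k :: "(int ^ 'd \<Rightarrow> 'a) \<Rightarrow> real"
    assume "i \<in> F (Suc t) - F t" "finite E" "{i} \<inter> E = {}" "D \<union> F t \<subseteq> E" "depends_on E k" "\<And>x. 0 \<le> k x"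
    then show "expectation (\<lambda>\<omega>. k (conf \<omega>) * g i (conf \<omega>)) \<le> 1 * expectation (\<lambda>\<omega>. k (conf \<omega>))"
      using step[of i E k] sub by auto
  qed (use F(2) nonneg sub D g in auto)
  then have "expectation (\<lambda>\<omega>. ?l (conf \<omega>) + ?k (conf \<omega>) * ?\<Pi> (conf \<omega>))
      \<le> expectation (\<lambda>\<omega>. ?l (conf \<omega>) + ?k (conf \<omega>))"
    using int by (simp add: Bochner_Integration.integral_add)
  also have "(\<lambda>\<omega>. ?l (conf \<omega>) + ?k (conf \<omega>)) = (\<lambda>\<omega>. ?V (conf \<omega>))"
    by (auto simp: of_bool_def fun_eq_iff)
  also have "(\<lambda>\<omega>. ?l (conf \<omega>) + ?k (conf \<omega>) * ?\<Pi> (conf \<omega>))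
      = (\<lambda>\<omega>. stopped_prod c g F (Suc t) (conf \<omega>))"
    by (auto simp: of_bool_def fun_eq_iff)
  finally show ?case
    using Suc by simp
qed

text \<open>
Ville's maximal inequality: Markov's inequality for the stopped product controls all times
\<open>t \<le> m\<close> at once, at the cost of a single one.
\<close>
lemma prob_ex_prod_ge_le:
  assumes F: "incseq F" "\<And>t. finite (F t)" and D: "finite D" "D \<inter> F m = {}"
    and g: "\<And>i x. 0 \<le> g i x" "\<And>i. i \<in> F m \<Longrightarrow> depends_on (insert i D) (g i)"
    and step: "\<And>i E k. i \<in> F m \<Longrightarrow> finite E \<Longrightarrow> D \<subseteq> E \<Longrightarrow> i \<notin> E \<Longrightarrow>
       depends_on E k \<Longrightarrow> (\<And>x. 0 \<le> k x) \<Longrightarrow>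
       expectation (\<lambda>\<omega>. k (conf \<omega>) * g i (conf \<omega>)) \<le> expectation (\<lambda>\<omega>. k (conf \<omega>))"
    and c: "0 < c"
  shows "\<P>(\<omega> in M. \<exists>t\<le>m. c \<le> (\<Prod>i\<in>F t. g i (conf \<omega>))) \<le> 1 / c"
proof -
  let ?V = "stopped_prod c g F m"
  have fin: "finite (D \<union> F m)"
    using D F(2) by auto
  have V: "depends_on (D \<union> F m) ?V"
    by (intro depends_on_stopped_prod F(1) g(2))
  have ge: "depends_on (D \<union> F m) (\<lambda>x. c \<le> ?V x)"
    using V by (rule depends_on_compose)
  have nonneg: "0 \<le> ?V x" for x
    by (rule stopped_prod_nonneg) (rule g)
  have "\<P>(\<omega> in M. \<exists>t\<le>m. c \<le> (\<Prod>i\<in>F t. g i (conf \<omega>))) \<le> \<P>(\<omega> in M. c \<le> ?V (conf \<omega>))"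
  proof (intro finite_measure_mono local_event[OF fin ge] subsetI)
    fix \<omega> assume "\<omega> \<in> {\<omega> \<in> space M. \<exists>t\<le>m. c \<le> (\<Prod>i\<in>F t. g i (conf \<omega>))}"
    then obtain t where t: "\<omega> \<in> space M" "t \<le> m" "c \<le> (\<Prod>i\<in>F t. g i (conf \<omega>))"
      by blast
    have "c \<le> ?V (conf \<omega>)"
    proof (rule ccontr)
      assume "\<not> c \<le> ?V (conf \<omega>)"
      then have "?V (conf \<omega>) < c" by simp
      from stopped_prod_not_stopped[OF F this] t(2) have "(\<Prod>i\<in>F t. g i (conf \<omega>)) < c"
        by blast
      with t(3) show False by simp
    qed
    with t show "\<omega> \<in> {\<omega> \<in> space M. c \<le> ?V (conf \<omega>)}"
      by simp
  qed
  also have "\<dots> \<le> expectation (\<lambda>\<omega>. ?V (conf \<omega>)) / c"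
    using integral_Markov_inequality_measure[OF integrable_local_fun[OF fin V], of "{}" c]
      nonneg c by simp
  also have "\<dots> \<le> 1 / c"
  proof (rule divide_right_mono)
    show "expectation (\<lambda>\<omega>. ?V (conf \<omega>)) \<le> 1"
      by (rule expectation_stopped_prod_le[where D = D and m = m and t = m])
        (fact F D g order_refl | rule step, assumption+)+
  qed (use c in simp)
  finally show ?thesis .
qed

end

section \<open>Innovations at the occurrences of a block\<close>

definition occurs :: "(int ^ 'd) set \<Rightarrow> (int ^ 'd \<Rightarrow> 'a) \<Rightarrow> int ^ 'd \<Rightarrow> (int ^ 'd \<Rightarrow> 'a) \<Rightarrow> real" where
  "occurs \<Gamma> a i x = of_bool (\<forall>j\<in>\<Gamma>. x (i + j) = a j)"

lemma depends_on_occurs: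
  fixes a :: "int ^ 'd \<Rightarrow> 'a"
  assumes "translate \<Gamma> i \<subseteq> D"
  shows "depends_on D (occurs \<Gamma> a i)"
proof (rule depends_onI)
  fix x y :: "int ^ 'd \<Rightarrow> 'a"
  assume "\<And>j. j \<in> D \<Longrightarrow> x j = y j"
  then have "x (i + j) = y (i + j)" if "j \<in> \<Gamma>" for j
    using that assms by (auto simp: translate_def)
  then show "occurs \<Gamma> a i x = occurs \<Gamma> a i y"
    unfolding occurs_def by (intro arg_cong[where f = of_bool] ball_cong) simp_all
qed

lemma Markov_neighborhoodD:
  assumes "Markov_neighborhood M X \<Gamma>"
  shows "finite \<Gamma>" "0 \<notin> \<Gamma>"
    and "finite \<Delta> \<Longrightarrow> \<Gamma> \<subset> \<Delta> \<Longrightarrow> 0 \<notin> \<Delta> \<Longrightarrow>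
      block_cond_prob M X {i} (translate \<Delta> i) a = block_cond_prob M X {i} (translate \<Gamma> i) a"
    and "block_cond_prob M X {i} (translate \<Gamma> i) (\<lambda>j. a (j - i)) = block_cond_prob M X {0} \<Gamma> a"
  using assms by (simp_all add: Markov_neighborhood_def neighborhood_def)

locale positive_field = finite_valued_field M X
  for M :: "'w measure" and X :: "int ^ 'd::finite \<Rightarrow> 'w \<Rightarrow> 'a::finite" +
  assumes positive: "positive_marginals M X"
begin

lemma block_prob_pos: "finite D \<Longrightarrow> block_prob M X D b > 0"
  using positive by (auto simp: positive_marginals_def)

text \<open>
The Markov property for an arbitrary finite set \<open>D\<close> that contains the neighborhood of \<open>i\<close> but not
\<open>i\<close>, with the site-independent conditional probability at the origin.
\<close>
lemma block_prob_insert_Markov: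
  assumes \<Gamma>: "Markov_neighborhood M X \<Gamma>" and D: "finite D" "i \<notin> D" "translate \<Gamma> i \<subseteq> D"
  shows "block_prob M X (insert i D) b
       = block_cond_prob M X {0} \<Gamma> (\<lambda>j. b (i + j)) * block_prob M X D b"
proof -
  define \<Delta> where "\<Delta> = (\<lambda>j. j - i) ` D"
  have tr: "translate \<Delta> i = D"
    by (simp add: \<Delta>_def translate_def image_image)
  have sub: "\<Gamma> \<subseteq> \<Delta>"
  proof
    fix j assume "j \<in> \<Gamma>"
    then have "i + j \<in> D"
      using D(3) by (auto simp: translate_def)
    then have "(i + j) - i \<in> \<Delta>"
      unfolding \<Delta>_def by (rule imageI)
    then show "j \<in> \<Delta>" by simp
  qed
  have \<Delta>: "finite \<Delta>" "0 \<notin> \<Delta>"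
    using D by (auto simp: \<Delta>_def)
  have "block_cond_prob M X {i} D b = block_cond_prob M X {i} (translate \<Gamma> i) b"
  proof (cases "\<Gamma> = \<Delta>")
    case False
    with sub \<Delta> have "block_cond_prob M X {i} (translate \<Delta> i) b
        = block_cond_prob M X {i} (translate \<Gamma> i) b"
      by (intro Markov_neighborhoodD(3)[OF \<Gamma>]) auto
    then show ?thesis by (simp add: tr)
  qed (simp add: tr)
  also have "\<dots> = block_cond_prob M X {0} \<Gamma> (\<lambda>j. b (i + j))"
    using Markov_neighborhoodD(4)[OF \<Gamma>, of i "\<lambda>j. b (i + j)"] by simp
  finally show ?thesis
    using block_prob_pos[OF D(1), of b] by (simp add: block_cond_prob_eq field_simps)
qed

lemma block_cond_prob_bounds:
  assumes "finite D"
  shows "0 < block_cond_prob M X {i} D b" "block_cond_prob M X {i} D b \<le> 1"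
proof -
  have "block_prob M X (insert i D) b \<le> block_prob M X D b"
    unfolding block_prob_def using assms by (intro finite_measure_mono) auto
  then show "0 < block_cond_prob M X {i} D b" "block_cond_prob M X {i} D b \<le> 1"
    using block_prob_pos assms by (auto simp: block_cond_prob_eq)
qed

text \<open>
At an occurrence of the block \<open>a\<close> around \<open>i\<close>, the difference between the indicator of the central
symbol and its conditional probability. Its sum over the core is
$N_n(a(\Gamma,0)) - N_n(a(\Gamma))\,Q(a(0)|a(\Gamma))$.
\<close>
definition innovation :: "(int ^ 'd) set \<Rightarrow> (int ^ 'd \<Rightarrow> 'a) \<Rightarrow> int ^ 'd \<Rightarrow> (int ^ 'd \<Rightarrow> 'a) \<Rightarrow> real" where
  "innovation \<Gamma> a i x =
     occurs \<Gamma> a i x * (of_bool (x i = a 0) - block_cond_prob M X {0} \<Gamma> a)"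

lemma depends_on_innovation:
  "translate \<Gamma> i \<subseteq> D \<Longrightarrow> i \<in> D \<Longrightarrow> depends_on D (innovation \<Gamma> a i)"
  unfolding innovation_def
  by (rule depends_on_mult[OF depends_on_occurs]) (auto intro!: depends_onI)

text \<open>
The factor whose product over a set of sites is $\exp(l S - l^2 N/8)$, with $S$ the sum of the
innovations and $N$ the number of occurrences. It equals 1 where the block does not occur.
\<close>
abbreviation tilt where
  "tilt \<Gamma> a l i x \<equiv> exp (l * innovation \<Gamma> a i x - l\<^sup>2 / 8 * occurs \<Gamma> a i x)"

lemma depends_on_tilt:
  "translate \<Gamma> i \<subseteq> D \<Longrightarrow> i \<in> D \<Longrightarrow> depends_on D (tilt \<Gamma> a l i)"
  by (rule depends_on_compose2[OF depends_on_innovation depends_on_occurs])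

text \<open>
When all the neighbors of \<open>i\<close> are known but \<open>i\<close> is not, the Markov property turns the
innovation into a centred Bernoulli variable (or zero), and Hoeffding's lemma bounds its
exponential moment by exactly the correction term $l^2/8$.
\<close>
lemma expectation_tilt_le:
  assumes \<Gamma>: "Markov_neighborhood M X \<Gamma>" and D: "finite D" "i \<notin> D" "translate \<Gamma> i \<subseteq> D"
    and k: "depends_on D k" "\<And>x. 0 \<le> k x"
  shows "expectation (\<lambda>\<omega>. k (conf \<omega>) * tilt \<Gamma> a l i (conf \<omega>)) \<le> expectation (\<lambda>\<omega>. k (conf \<omega>))"
proof -
  define Q where "Q = block_cond_prob M X {0} \<Gamma> a"
  have fin: "finite \<Gamma>" and 0: "0 \<notin> \<Gamma>"
    using Markov_neighborhoodD[OF \<Gamma>] by auto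
  have Q: "0 \<le> Q" "Q \<le> 1"
    using block_cond_prob_bounds[OF fin, of 0 a] by (auto simp: Q_def)
  have "expectation (\<lambda>\<omega>. k (conf \<omega>) * tilt \<Gamma> a l i (conf \<omega>)) \<le> 1 * expectation (\<lambda>\<omega>. k (conf \<omega>))"
  proof (rule expectation_insert_site_le[OF D(1,2) k])
    show "depends_on (insert i D) (tilt \<Gamma> a l i)"
      using D(3) by (intro depends_on_tilt) auto
    fix b :: "int ^ 'd \<Rightarrow> 'a"
    let ?P = "\<lambda>s. block_prob M X (insert i D) (b(i := s))"
    have upd: "(b(i := s)) (i + j) = b (i + j)" if "j \<in> \<Gamma>" for s j
      using that 0 by auto
    show "(\<Sum>s\<in>UNIV. tilt \<Gamma> a l i (b(i := s)) * ?P s) \<le> 1 * block_prob M X D b"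
    proof (cases "\<forall>j\<in>\<Gamma>. b (i + j) = a j")
      case False
      then have "occurs \<Gamma> a i (b(i := s)) = 0" for s
        using upd by (auto simp: occurs_def)
      then show ?thesis
        using sum_block_prob_insert[OF D(1,2)] by (simp add: innovation_def)
    next
      case True
      then have occ: "occurs \<Gamma> a i (b(i := s)) = 1" for s
        using upd by (auto simp: occurs_def)
      have Pa: "?P (a 0) = Q * block_prob M X D b"
      proof -
        have "?P (a 0) = block_cond_prob M X {0} \<Gamma> (\<lambda>j. (b(i := a 0)) (i + j))
            * block_prob M X D (b(i := a 0))"
          by (rule block_prob_insert_Markov[OF \<Gamma> D])
        also have "block_cond_prob M X {0} \<Gamma> (\<lambda>j. (b(i := a 0)) (i + j)) = Q"
          unfolding Q_def using True upd by (intro block_cond_prob_cong) auto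
        also have "block_prob M X D (b(i := a 0)) = block_prob M X D b"
          using D(2) by (intro block_prob_cong) auto
        finally show ?thesis .
      qed
      have rest: "(\<Sum>s\<in>UNIV - {a 0}. ?P s) = (1 - Q) * block_prob M X D b"
        using sum_block_prob_insert[OF D(1,2), of b] Pa
        by (subst (asm) sum.remove[of _ "a 0"]) (auto simp: algebra_simps)
      have "(\<Sum>s\<in>UNIV. tilt \<Gamma> a l i (b(i := s)) * ?P s)
          = exp (l * (1 - Q) - l\<^sup>2 / 8) * ?P (a 0) + (\<Sum>s\<in>UNIV - {a 0}. exp (- l * Q - l\<^sup>2 / 8) * ?P s)"
        by (subst sum.remove[of _ "a 0"])
           (auto simp: innovation_def occ Q_def intro!: sum.cong)
      also have "\<dots> = (Q * exp (l * (1 - Q)) + (1 - Q) * exp (- l * Q)) * exp (- l\<^sup>2 / 8)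
          * block_prob M X D b"
      proof -
        have "exp (u - l\<^sup>2 / 8) = exp u * exp (- l\<^sup>2 / 8)" for u
          by (simp flip: exp_add)
        then show ?thesis
          unfolding sum_distrib_left[symmetric] rest Pa by (simp only: ring_distribs mult_ac)
      qed
      also have "\<dots> \<le> exp (l\<^sup>2 / 8) * exp (- l\<^sup>2 / 8) * block_prob M X D b"
        using block_prob_pos[OF D(1), of b]
        by (intro mult_right_mono bernoulli_mgf_le Q) auto
      finally show ?thesis by (simp flip: exp_add)
    qed
  qed
  then show ?thesis by simp
qed

text \<open>
The event that the random walk of innovations along \<open>F\<close> ever crosses a line. The threshold
involves the random number of occurrences, so no lower bound on that number is needed here.
\<close>
definition deviation_event where
  "deviation_event l L \<Gamma> a F = {\<omega> \<in> space M. \<exists>t::nat. L \<le> l * (\<Sum>i\<in>F t. innovation \<Gamma> a i (conf \<omega>))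
                - l\<^sup>2 / 8 * (\<Sum>i\<in>F t. occurs \<Gamma> a i (conf \<omega>))}"

text \<open>
Since no site of \<open>F t\<close> is a neighbor of another one, all neighborhoods can be revealed before
any site of \<open>F t\<close>; then the tilts form a supermartingale and the maximal inequality applies with
$c = e^L$. The bound does not depend on the horizon, so it holds for all times together.
\<close>
lemma prob_deviation_event_le:
  assumes \<Gamma>: "Markov_neighborhood M X \<Gamma>"
    and F: "incseq F" "\<And>t. finite (F t)"
    and sep: "\<And>t i. i \<in> F t \<Longrightarrow> translate \<Gamma> i \<inter> F t = {}"
  shows "deviation_event l L \<Gamma> a F \<in> events"
    and "prob (deviation_event l L \<Gamma> a F) \<le> exp (- L)"
proof -
  \<comment> \<open>The sites revealed at the start: all neighborhoods up to the horizon.\<close>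
  let ?D = "\<lambda>t. \<Union>i\<in>F t. translate \<Gamma> i"
  let ?g = "\<lambda>x t. l * (\<Sum>i\<in>F t. innovation \<Gamma> a i x) - l\<^sup>2 / 8 * (\<Sum>i\<in>F t. occurs \<Gamma> a i x)"
  define A where "A m = {\<omega> \<in> space M. \<exists>t\<le>m. L \<le> ?g (conf \<omega>) t}" for m
  have fin: "finite \<Gamma>"
    using Markov_neighborhoodD[OF \<Gamma>] by auto
  have finD: "finite (?D m)" for m
    using F(2) fin by (auto simp: translate_def)
  have g_eq: "(\<Prod>i\<in>F t. tilt \<Gamma> a l i x) = exp (?g x t)" for t x
    by (simp only: exp_sum[OF F(2), symmetric] sum_subtractf sum_distrib_left)
  have ev: "A m \<in> events" for m
    unfolding A_def
  proof (rule local_event[where D = "?D m \<union> F m"])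
    have dep: "depends_on (?D m \<union> F m) (\<lambda>x. ?g x t)" if "t \<le> m" for t
    proof -
      have sub: "F t \<subseteq> F m"
        using F(1) that by (auto simp: incseq_def)
      have dep: "depends_on (?D m \<union> F m) (innovation \<Gamma> a i)" "depends_on (?D m \<union> F m) (occurs \<Gamma> a i)"
        if "i \<in> F t" for i
        using that sub by (intro depends_on_innovation depends_on_occurs; blast)+
      show ?thesis
        by (intro depends_onI arg_cong2[where f = "(-)"] arg_cong2[where f = "(*)"] refl sum.cong)
          (erule dep[THEN depends_onD], assumption)+
    qed
    show "depends_on (?D m \<union> F m) (\<lambda>x. \<exists>t\<le>m. L \<le> ?g x t)"
    proof (rule depends_onI)
      fix x y :: "int ^ 'd \<Rightarrow> 'a" assume "\<And>j. j \<in> ?D m \<union> F m \<Longrightarrow> x j = y j"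
      then have "?g x t = ?g y t" if "t \<le> m" for t
        using that by (intro depends_onD[OF dep]) auto
      then show "(\<exists>t\<le>m. L \<le> ?g x t) = (\<exists>t\<le>m. L \<le> ?g y t)"
        by (intro ex_cong1 conj_cong refl) (simp only:)
    qed
  qed (use finD F in auto)
  have le: "prob (A m) \<le> exp (- L)" for m
  proof -
    have "prob (A m) = \<P>(\<omega> in M. \<exists>t\<le>m. exp L \<le> (\<Prod>i\<in>F t. tilt \<Gamma> a l i (conf \<omega>)))"
      by (simp only: A_def g_eq exp_le_cancel_iff)
    also have "\<dots> \<le> 1 / exp L"
    proof (rule prob_ex_prod_ge_le[where D = "?D m" and g = "tilt \<Gamma> a l" and F = F and m = m])
      show "?D m \<inter> F m = {}"
        using sep by blast
    next
      fix i assume i: "i \<in> F m"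
      show "depends_on (insert i (?D m)) (tilt \<Gamma> a l i)"
        using i by (intro depends_on_tilt) auto
      fix E and k :: "(int ^ 'd \<Rightarrow> 'a) \<Rightarrow> real"
      assume E: "finite E" "?D m \<subseteq> E" "i \<notin> E" and k: "depends_on E k" "\<And>x. 0 \<le> k x"
      have "translate \<Gamma> i \<subseteq> E"
        using UN_upper[OF i] E(2) by (rule order_trans)
      then show "expectation (\<lambda>\<omega>. k (conf \<omega>) * tilt \<Gamma> a l i (conf \<omega>))
          \<le> expectation (\<lambda>\<omega>. k (conf \<omega>))"
        by (rule expectation_tilt_le[OF \<Gamma> E(1,3) _ k])
    qed (use finD F in auto)
    finally show ?thesis by (simp add: exp_minus inverse_eq_divide)
  qed
  have A: "deviation_event l L \<Gamma> a F = (\<Union>m. A m)"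
    by (auto simp: A_def deviation_event_def)
  show "deviation_event l L \<Gamma> a F \<in> events"
    unfolding A using ev by auto
  have "(\<lambda>m. prob (A m)) \<longlonglongrightarrow> prob (\<Union>m. A m)"
  proof (rule finite_Lim_measure_incseq)
    show "range A \<subseteq> events"
      using ev by blast
    show "incseq A"
      unfolding A_def by (rule incseq_SucI) (blast intro: le_SucI)
  qed
  then show "prob (deviation_event l L \<Gamma> a F) \<le> exp (- L)"
    unfolding A by (rule LIMSEQ_le_const2) (use le in auto)
qed

end


section \<open>Boxes and residue classes\<close>

definition box :: "nat \<Rightarrow> (int ^ 'd::finite) set" where
  "box R = {v. \<forall>c. v $ c \<in> {- int R..int R}}"

definition residue :: "nat \<Rightarrow> int ^ 'd::finite \<Rightarrow> int ^ 'd" where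
  "residue s v = (\<chi> c. v $ c mod int s)"

definition residues :: "nat \<Rightarrow> (int ^ 'd::finite) set" where
  "residues s = {v. \<forall>c. v $ c \<in> {0..<int s}}"

lemma finite_card_vec_Pi:
  fixes S :: "'b set"
  assumes "finite S"
  shows "finite {v :: 'b ^ 'd::finite. \<forall>c. v $ c \<in> S}"
    and "card {v :: 'b ^ 'd::finite. \<forall>c. v $ c \<in> S} = card S ^ CARD('d)"
proof -
  have eq: "{v :: 'b ^ 'd::finite. \<forall>c. v $ c \<in> S} = vec_lambda ` (UNIV \<rightarrow>\<^sub>E S)"
  proof (intro equalityI subsetI)
    fix v :: "'b ^ 'd" assume "v \<in> {v. \<forall>c. v $ c \<in> S}"
    then have "vec_nth v \<in> UNIV \<rightarrow>\<^sub>E S" by auto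
    then have "vec_lambda (vec_nth v) \<in> vec_lambda ` (UNIV \<rightarrow>\<^sub>E S)" by (rule imageI)
    then show "v \<in> vec_lambda ` (UNIV \<rightarrow>\<^sub>E S)" by simp
  qed auto
  have "inj (vec_lambda :: ('d \<Rightarrow> 'b) \<Rightarrow> 'b ^ 'd)"
    by (auto simp: inj_def vec_lambda_inject)
  then show "card {v :: 'b ^ 'd::finite. \<forall>c. v $ c \<in> S} = card S ^ CARD('d)"
    unfolding eq by (subst card_image) (auto simp: card_PiE inj_on_def)
  show "finite {v :: 'b ^ 'd::finite. \<forall>c. v $ c \<in> S}"
    unfolding eq using assms by (intro finite_imageI finite_PiE) auto
qed

lemma finite_box [simp]: "finite (box R)"
  unfolding box_def by (rule finite_card_vec_Pi) simp

lemma card_box: "card (box R :: (int ^ 'd::finite) set) = (2 * R + 1) ^ CARD('d)"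
  unfolding box_def by (subst finite_card_vec_Pi(2)) (simp_all add: nat_add_distrib nat_mult_distrib)

lemma finite_residues [simp]: "finite (residues s)"
  unfolding residues_def by (rule finite_card_vec_Pi) simp

lemma card_residues: "card (residues s :: (int ^ 'd::finite) set) = s ^ CARD('d)"
  unfolding residues_def by (subst finite_card_vec_Pi(2)) (simp_all add: nat_add_distrib nat_mult_distrib)

lemma residue_in_residues: "s > 0 \<Longrightarrow> residue s v \<in> residues s"
  by (simp add: residue_def residues_def)

lemma zero_in_box [simp]: "0 \<in> box R"
  by (simp add: box_def)

lemma maxnorm_le_iff: "maxnorm v \<le> r \<longleftrightarrow> (\<forall>c. \<bar>v $ c\<bar> \<le> r)"
  unfolding maxnorm_def by (subst Max_le_iff) auto

lemma in_box_iff_maxnorm: "v \<in> box R \<longleftrightarrow> maxnorm v \<le> int R"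
proof -
  have "x \<in> {- int R..int R} \<longleftrightarrow> \<bar>x\<bar> \<le> int R" for x
    by auto
  then show ?thesis
    unfolding box_def maxnorm_le_iff by (simp only: mem_Collect_eq)
qed

lemma subset_box_if_radius_le:
  assumes "finite \<Gamma>" "radius \<Gamma> \<le> int R"
  shows "\<Gamma> \<subseteq> box R"
proof
  fix v assume v: "v \<in> \<Gamma>"
  then have "maxnorm v \<le> Max (maxnorm ` \<Gamma>)"
    using assms(1) by (intro Max_ge) auto
  also have "\<dots> = radius \<Gamma>"
    using v by (auto simp: radius_def)
  also have "\<dots> \<le> int R"
    by (rule assms(2))
  finally show "v \<in> box R"
    by (simp add: in_box_iff_maxnorm)
qed

text \<open>
Two sites whose boxes of radius \<open>R\<close> meet differ by at most \<open>2 * R\<close> in every coordinate, which is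
less than the period of the residue classes.
\<close>
lemma same_residue_boxes_meet:
  assumes "residue (2 * R + 1) i = residue (2 * R + 1) j" "u \<in> box R" "v \<in> box R" "i + u = j + v"
  shows "i = j"
proof (rule vec_eq_iff[THEN iffD2], rule allI)
  fix c
  have "(i $ c) mod int (2 * R + 1) = (j $ c) mod int (2 * R + 1)"
    using assms(1) by (simp add: residue_def vec_eq_iff)
  then have dvd: "int (2 * R + 1) dvd i $ c - j $ c"
    by (simp add: mod_eq_dvd_iff)
  have "i $ c + u $ c = j $ c + v $ c"
    using assms(4) by (metis vector_add_component)
  moreover have "- int R \<le> u $ c" "u $ c \<le> int R" "- int R \<le> v $ c" "v $ c \<le> int R"
    using assms(2,3) by (auto simp: box_def)
  ultimately have "\<bar>i $ c - j $ c\<bar> < int (2 * R + 1)"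
    by linarith
  with dvd show "i $ c = j $ c"
    using dvd_imp_le_int[of "i $ c - j $ c" "int (2 * R + 1)"] by force
qed

lemma exists_large_residue_class:
  fixes C :: "(int ^ 'd::finite) set"
  assumes "finite C" "s > 0"
  shows "\<exists>k\<in>residues s. card C \<le> s ^ CARD('d) * card {i \<in> C. residue s i = k}"
proof (rule ccontr)
  assume "\<not> ?thesis"
  then have less: "s ^ CARD('d) * card {i \<in> C. residue s i = k} < card C" if "k \<in> residues s" for k
    using that by auto
  have "residues s \<noteq> ({} :: (int ^ 'd) set)"
    using residue_in_residues[OF assms(2)] by blast
  then have "(\<Sum>k\<in>residues s. s ^ CARD('d) * card {i \<in> C. residue s i = k})
      < (\<Sum>k\<in>(residues s :: (int ^ 'd) set). card C)"
    by (intro sum_strict_mono less) auto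
  moreover have "(\<Sum>k\<in>residues s. card {i \<in> C. residue s i = k}) = card C"
    using sum.group[OF assms(1) finite_residues[of s], of "residue s" "\<lambda>_. 1 :: nat"]
      residue_in_residues[OF assms(2)] by auto
  ultimately show False
    by (simp add: card_residues flip: sum_distrib_left)
qed

section \<open>Blocks occur often\<close>

context positive_field
begin

text \<open>
A symbol has conditional probability at least \<open>q\<close> at any site, given any block on other sites; the
weight \<open>k\<close> plays the role of the conditioning.
\<close>
definition uniform_site_bound :: "real \<Rightarrow> bool" where
  "uniform_site_bound q \<longleftrightarrow> 0 < q \<and> q \<le> 1 \<and>
     (\<forall>D i k s. finite D \<and> i \<notin> D \<and> depends_on D k \<and> (\<forall>x. 0 \<le> k x) \<longrightarrow>
        q * expectation (\<lambda>\<omega>. k (conf \<omega>)) \<le> expectation (\<lambda>\<omega>. k (conf \<omega>) * of_bool (X i \<omega> = s)))"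

lemma uniform_site_boundD:
  "uniform_site_bound q \<Longrightarrow> finite D \<Longrightarrow> i \<notin> D \<Longrightarrow> depends_on D k \<Longrightarrow> (\<And>x. 0 \<le> k x) \<Longrightarrow>
    q * expectation (\<lambda>\<omega>. k (conf \<omega>)) \<le> expectation (\<lambda>\<omega>. k (conf \<omega>) * of_bool (X i \<omega> = s))"
  by (simp add: uniform_site_bound_def)

text \<open>
Given its neighborhood, a site takes each symbol with one of finitely many positive probabilities,
the same ones at every site; \<open>q\<close> is their minimum. If the conditioning block does not contain the
neighborhood, it is enlarged by it first, which is harmless because the bound is uniform over
the added symbols.
\<close>
lemma exists_uniform_site_bound:
  assumes "Markov_neighborhood M X \<Gamma>"
  shows "\<exists>q. uniform_site_bound q"
proof -
  let ?c = "block_cond_prob M X {0} \<Gamma>"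
  let ?A = "insert 0 \<Gamma> \<rightarrow>\<^sub>E (UNIV :: 'a set)"
  define q where "q = Min (?c ` ?A)"
  have fin: "finite \<Gamma>" and 0: "0 \<notin> \<Gamma>"
    using Markov_neighborhoodD[OF assms] by auto
  have A: "finite ?A" "?A \<noteq> {}"
    using fin by (auto intro: finite_PiE simp: PiE_eq_empty_iff)
  have "q \<in> ?c ` ?A"
    unfolding q_def using A by (intro Min_in) auto
  then have q: "0 < q" "q \<le> 1"
    using block_cond_prob_bounds[OF fin] by auto
  have q_le: "q \<le> ?c b" for b
  proof -
    have "q \<le> ?c (restrict b (insert 0 \<Gamma>))"
      unfolding q_def using A by (intro Min_le) auto
    also have "\<dots> = ?c b"
      by (intro block_cond_prob_cong) auto
    finally show ?thesis .
  qed
  show ?thesis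
    unfolding uniform_site_bound_def
  proof (intro exI[of _ q] conjI q allI impI, elim conjE)
    fix D i s and k :: "(int ^ 'd \<Rightarrow> 'a) \<Rightarrow> real"
    assume D: "finite D" "i \<notin> D" and k: "depends_on D k" "\<forall>x. 0 \<le> k x"
    let ?E = "D \<union> translate \<Gamma> i"
    have E: "finite ?E" "i \<notin> ?E"
      using D fin 0 by (auto simp: translate_def)
    have "expectation (\<lambda>\<omega>. k (conf \<omega>) * - of_bool (conf \<omega> i = s))
        \<le> - q * expectation (\<lambda>\<omega>. k (conf \<omega>))"
    proof (rule expectation_insert_site_le[OF E])
      show "depends_on ?E k"
        using k(1) by (rule depends_on_mono) auto
      show "depends_on (insert i ?E) (\<lambda>x. - of_bool (x i = s) :: real)"
        by (rule depends_onI) simp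
      fix b :: "int ^ 'd \<Rightarrow> 'a"
      let ?P = "block_prob M X (insert i ?E)"
      have "(\<Sum>t\<in>UNIV. - of_bool ((b(i := t)) i = s) * ?P (b(i := t)))
          = (\<Sum>t\<in>UNIV. if t = s then - ?P (b(i := s)) else 0)"
        by (intro sum.cong) auto
      also have "\<dots> = - (?c (\<lambda>j. (b(i := s)) (i + j)) * block_prob M X ?E (b(i := s)))"
        using block_prob_insert_Markov[OF assms E, of "b(i := s)"] by (subst sum.delta) auto
      also have "\<dots> \<le> - (q * block_prob M X ?E (b(i := s)))"
        using block_prob_pos[OF E(1), of "b(i := s)"] q_le
        by (intro le_imp_neg_le mult_right_mono) auto
      also have "block_prob M X ?E (b(i := s)) = block_prob M X ?E b"
        using E(2) by (intro block_prob_cong) auto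
      finally show "(\<Sum>t\<in>UNIV. - of_bool ((b(i := t)) i = s) * ?P (b(i := t)))
          \<le> - q * block_prob M X ?E b"
        by (simp only: mult_minus_left)
    qed (use k(2) in blast)
    then show "q * expectation (\<lambda>\<omega>. k (conf \<omega>)) \<le> expectation (\<lambda>\<omega>. k (conf \<omega>) * of_bool (X i \<omega> = s))"
      by simp
  qed
qed

lemma expectation_block_ge:
  fixes k :: "(int ^ 'd \<Rightarrow> 'a) \<Rightarrow> real"
  assumes q: "uniform_site_bound q"
    and "finite \<Phi>" "finite D" "\<Phi> \<inter> D = {}" "depends_on D k" "\<And>x. 0 \<le> k x"
  shows "q ^ card \<Phi> * expectation (\<lambda>\<omega>. k (conf \<omega>))
       \<le> expectation (\<lambda>\<omega>. k (conf \<omega>) * of_bool (\<forall>j\<in>\<Phi>. X j \<omega> = a j))"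
  using assms(2,4)
proof (induction \<Phi> rule: finite_induct)
  case (insert i \<Phi>)
  let ?k = "\<lambda>x. k x * of_bool (\<forall>j\<in>\<Phi>. x j = a j)"
  have dep: "depends_on (D \<union> \<Phi>) ?k"
    by (intro depends_on_mult depends_on_mono[OF assms(5)] depends_onI
        arg_cong[where f = of_bool] ball_cong) auto
  have "q ^ card (insert i \<Phi>) * expectation (\<lambda>\<omega>. k (conf \<omega>))
      = q * (q ^ card \<Phi> * expectation (\<lambda>\<omega>. k (conf \<omega>)))"
    using insert.hyps by simp
  also have "\<dots> \<le> q * expectation (\<lambda>\<omega>. ?k (conf \<omega>))"
    using insert.prems q by (intro mult_left_mono insert.IH) (auto simp: uniform_site_bound_def)
  also have "\<dots> \<le> expectation (\<lambda>\<omega>. ?k (conf \<omega>) * of_bool (X i \<omega> = a i))"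
    using insert.hyps insert.prems assms(3,6) dep
    by (intro uniform_site_boundD[OF q _ _ dep]) auto
  also have "(\<lambda>\<omega>. ?k (conf \<omega>) * of_bool (X i \<omega> = a i))
      = (\<lambda>\<omega>. k (conf \<omega>) * of_bool (\<forall>j\<in>insert i \<Phi>. X j \<omega> = a j))"
    by (auto simp: fun_eq_iff)
  finally show ?case .
qed simp

text \<open>
Chernoff's bound. The windows \<open>translate W i\<close> are disjoint, and whatever happens in the others, the
block occurs in each with conditional probability at least \<open>q ^ card W\<close>. So the number of
occurrences dominates a binomial variable and rarely falls below a quarter of the mean.
\<close>
lemma prob_few_occurrences_le:
  assumes q: "uniform_site_bound q" and W: "finite W" and I: "finite I"
    and disj: "\<And>i j. i \<in> I \<Longrightarrow> j \<in> I \<Longrightarrow> i \<noteq> j \<Longrightarrow> translate W i \<inter> translate W j = {}"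
  shows "{\<omega> \<in> space M. (\<Sum>i\<in>I. occurs W a i (conf \<omega>)) < q ^ card W * card I / 4} \<in> events"
    and "\<P>(\<omega> in M. (\<Sum>i\<in>I. occurs W a i (conf \<omega>)) < q ^ card W * card I / 4)
       \<le> exp (- (q ^ card W * card I / 4))"
proof -
  let ?U = "\<Union>i\<in>I. translate W i"
  let ?p = "q ^ card W"
  \<comment> \<open>The product of these factors is $2^{-N}$ with $N$ the number of occurrences.\<close>
  let ?g = "\<lambda>i x. 1 - occurs W a i x / 2"
  let ?few = "\<lambda>x. (\<Sum>i\<in>I. occurs W a i x) < ?p * card I / 4"
  have p: "0 < ?p" "?p \<le> 1"
    using q by (auto simp: uniform_site_bound_def intro: power_le_one)
  have finU: "finite ?U"
    using W I by (auto simp: translate_def)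
  have occ: "depends_on ?U (occurs W a i)" if "i \<in> I" for i
    using that by (intro depends_on_occurs) auto
  have occ01: "occurs W a i x = 0 \<or> occurs W a i x = 1" for i x
    by (auto simp: occurs_def)
  have few: "depends_on ?U ?few"
    by (rule depends_onI, rule arg_cong[where f = "\<lambda>v. v < _"], rule sum.cong[OF refl])
       (rule depends_onD[OF occ])
  show ev: "{\<omega> \<in> space M. ?few (conf \<omega>)} \<in> events"
    by (rule local_event[OF finU few])
  have prod: "depends_on ?U (\<lambda>x. \<Prod>i\<in>I. ?g i x)"
    by (intro depends_on_prod depends_on_compose[OF occ])
  have exp_half: "exp (- 1) \<le> (1 / 2 :: real)"
  proof -
    have "(2 :: real) \<le> exp 1" using exp_ge_add_one_self[of "1 :: real"] by simp
    then show ?thesis by (simp add: exp_minus field_simps)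
  qed
  have step: "expectation (\<lambda>\<omega>. k (conf \<omega>) * ?g i (conf \<omega>)) \<le> (1 - ?p / 2) * expectation (\<lambda>\<omega>. k (conf \<omega>))"
    if E: "finite E" "translate W i \<inter> E = {}" and k: "depends_on E k" "\<And>x. 0 \<le> k x"
    for i E and k :: "(int ^ 'd \<Rightarrow> 'a) \<Rightarrow> real"
  proof -
    have fin: "finite (translate W i)" and card: "card (translate W i) = card W"
      using W by (auto simp: translate_def intro!: card_image inj_onI)
    have kocc: "depends_on (E \<union> translate W i) (\<lambda>x. k x * occurs W a i x)"
      by (intro depends_on_mult depends_on_mono[OF k(1)] depends_on_occurs) auto
    have "?p * expectation (\<lambda>\<omega>. k (conf \<omega>))
        \<le> expectation (\<lambda>\<omega>. k (conf \<omega>) * of_bool (\<forall>j\<in>translate W i. X j \<omega> = a (j - i)))"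
      using expectation_block_ge[OF q fin E k, of "\<lambda>j. a (j - i)"] by (simp add: card)
    also have "\<dots> = expectation (\<lambda>\<omega>. k (conf \<omega>) * occurs W a i (conf \<omega>))"
      by (simp add: occurs_def translate_def)
    finally have "?p * expectation (\<lambda>\<omega>. k (conf \<omega>)) \<le> \<dots>" .
    moreover have "expectation (\<lambda>\<omega>. k (conf \<omega>) * ?g i (conf \<omega>))
        = expectation (\<lambda>\<omega>. k (conf \<omega>)) - expectation (\<lambda>\<omega>. k (conf \<omega>) * occurs W a i (conf \<omega>)) / 2"
      using integrable_local_fun[OF E(1) k(1)] integrable_local_fun[OF _ kocc] E(1) fin
      by (simp add: right_diff_distrib)
    ultimately show ?thesis
      by (simp add: algebra_simps)
  qed
  have "expectation (\<lambda>\<omega>. 1 * (\<Prod>i\<in>I. ?g i (conf \<omega>))) \<le> (1 - ?p / 2) ^ card I * expectation (\<lambda>\<omega>. 1)"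
  proof (rule expectation_prod_sites_le[OF I, where D = "{}" and B = "translate W" and N = "translate W"])
    fix i x assume "i \<in> I"
    have "depends_on (translate W i) (?g i)"
      by (rule depends_on_compose[OF depends_on_occurs]) simp
    then show "finite (translate W i) \<and> depends_on (translate W i) (?g i)"
      using W by (simp add: translate_def)
    show "0 \<le> ?g i x"
      using occ01[of i x] by auto
  next
    fix i j assume "i \<in> I" "j \<in> I" "i \<noteq> j"
    then show "translate W i \<inter> translate W j = {}" by (rule disj)
  next
    fix i E and k :: "(int ^ 'd \<Rightarrow> 'a) \<Rightarrow> real"
    assume "finite E" "translate W i \<inter> E = {}" "depends_on E k" "\<And>x. 0 \<le> k x"
    then show "expectation (\<lambda>\<omega>. k (conf \<omega>) * ?g i (conf \<omega>)) \<le> (1 - ?p / 2) * expectation (\<lambda>\<omega>. k (conf \<omega>))"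
      by (rule step)
  qed (use p in \<open>auto simp: depends_on_def\<close>)
  also have "\<dots> \<le> exp (- ?p / 2) ^ card I"
    using p exp_ge_add_one_self[of "- ?p / 2"] by (auto simp: prob_space intro!: power_mono)
  also have "\<dots> = exp (- (?p * card I / 2))"
    by (simp flip: exp_of_nat_mult)
  finally have E_le: "expectation (\<lambda>\<omega>. \<Prod>i\<in>I. ?g i (conf \<omega>)) \<le> exp (- (?p * card I / 2))"
    by simp
  have prod_nonneg: "0 \<le> (\<Prod>i\<in>I. ?g i x)" for x
    by (intro prod_nonneg) (auto simp: occurs_def)
  have "prob {\<omega> \<in> space M. ?few (conf \<omega>)}
      \<le> \<P>(\<omega> in M. exp (- (?p * card I / 4)) \<le> (\<Prod>i\<in>I. ?g i (conf \<omega>)))"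
  proof (rule finite_measure_mono)
    show "{\<omega> \<in> space M. exp (- (?p * card I / 4)) \<le> (\<Prod>i\<in>I. ?g i (conf \<omega>))} \<in> events"
      by (rule local_event[OF finU depends_on_compose[OF prod]])
    show "{\<omega> \<in> space M. ?few (conf \<omega>)}
        \<subseteq> {\<omega> \<in> space M. exp (- (?p * card I / 4)) \<le> (\<Prod>i\<in>I. ?g i (conf \<omega>))}"
    proof safe
      fix \<omega> assume few: "?few (conf \<omega>)"
      have "exp (- (?p * card I / 4)) \<le> exp (\<Sum>i\<in>I. - occurs W a i (conf \<omega>))"
        using few by (simp add: sum_negf)
      also have "\<dots> = (\<Prod>i\<in>I. exp (- occurs W a i (conf \<omega>)))"
        by (rule exp_sum[OF I])
      also have "\<dots> \<le> (\<Prod>i\<in>I. ?g i (conf \<omega>))"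
        using exp_half by (intro prod_mono) (auto simp: occurs_def)
      finally show "exp (- (?p * card I / 4)) \<le> (\<Prod>i\<in>I. ?g i (conf \<omega>))" .
    qed
  qed
  also have "\<dots> \<le> expectation (\<lambda>\<omega>. \<Prod>i\<in>I. ?g i (conf \<omega>)) / exp (- (?p * card I / 4))"
    using integral_Markov_inequality_measure[OF integrable_local_fun[OF finU prod], of "{}"]
      prod_nonneg by simp
  also have "\<dots> \<le> exp (- (?p * card I / 2)) / exp (- (?p * card I / 4))"
    by (intro divide_right_mono E_le) simp
  also have "\<dots> = exp (- (?p * card I / 4))"
    by (simp flip: exp_diff)
  finally show "prob {\<omega> \<in> space M. ?few (conf \<omega>)} \<le> exp (- (?p * card I / 4))" .
qed

end


section \<open>Growth of the box volume and of the test level\<close>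

lemma powr_le_one_plus: "0 \<le> x \<Longrightarrow> 0 \<le> e \<Longrightarrow> e \<le> 1 \<Longrightarrow> x powr e \<le> 1 + (x::real)"
proof -
  assume x: "0 \<le> x" "0 \<le> e" "e \<le> 1"
  have "x powr e \<le> (1 + x) powr e"
    using x by (intro powr_mono2) auto
  also have "\<dots> \<le> (1 + x) powr 1"
    using x by (intro powr_mono) auto
  finally show ?thesis using x by simp
qed

text \<open>
The exponent $1/(2d)$ in the bound on the radius is what makes the square of the volume of the box
comparable to $\ln c$: here \<open>c\<close> stands for the size of the core.
\<close>
lemma box_volume_asymp:
  fixes \<alpha> :: real and d :: nat
  assumes "0 < \<alpha>" "0 < d"
  shows "((\<lambda>c. (2 * (\<alpha> * ln c) powr (1 / (2 * real d)) + 1) ^ d / sqrt (ln c)) \<longlongrightarrow> 2 ^ d * sqrt \<alpha>) at_top"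
proof -
  let ?x = "\<lambda>c::real. (\<alpha> * ln c) powr (1 / (2 * real d))"
  have e: "1 / (2 * real d) > 0"
    using assms(2) by simp
  have "filterlim (\<lambda>c. \<alpha> * ln c) at_top at_top"
    using assms(1) by real_asymp
  moreover
  have "filterlim (\<lambda>y::real. y powr (1 / (2 * real d))) at_top at_top"
    using e by real_asymp
  ultimately have x: "filterlim ?x at_top at_top"
    by (rule filterlim_compose[rotated])
  have "((\<lambda>z::real. (2 * z + 1) / z) \<longlongrightarrow> 2) at_top"
    by real_asymp
  from filterlim_compose[OF this x]
  have lim: "((\<lambda>c. ((2 * ?x c + 1) / ?x c) ^ d * sqrt \<alpha>) \<longlongrightarrow> 2 ^ d * sqrt \<alpha>) at_top"
    by (intro tendsto_intros)
  have "\<forall>\<^sub>F c::real in at_top. c > 1"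
    by (rule eventually_gt_at_top)
  then have "\<forall>\<^sub>F c in at_top. ((2 * ?x c + 1) / ?x c) ^ d * sqrt \<alpha> = (2 * ?x c + 1) ^ d / sqrt (ln c)"
  proof eventually_elim
    case (elim c)
    have "?x c ^ d = ?x c powr real d"
      using elim assms by (intro powr_realpow[symmetric]) simp
    also have "\<dots> = (\<alpha> * ln c) powr (1 / 2)"
      using assms(2) by (simp add: powr_powr)
    also have "\<dots> = sqrt \<alpha> * sqrt (ln c)"
      using elim assms by (simp add: powr_half_sqrt real_sqrt_mult)
    finally show ?case
      using elim assms by (simp add: power_divide)
  qed
  with lim show ?thesis
    by (rule Lim_transform_eventually)
qed

lemma eventually_box_volume_le_ln:
  fixes \<alpha> :: real and d :: nat
  assumes "0 < \<alpha>" "0 < d"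
  shows "\<forall>\<^sub>F c in at_top. \<forall>R::nat. real R \<le> (\<alpha> * ln c) powr (1 / (2 * real d)) \<longrightarrow>
           K * (2 * real R + 1) ^ d \<le> ln c"
proof -
  let ?u = "\<lambda>c. (2 * (\<alpha> * ln c) powr (1 / (2 * real d)) + 1) ^ d"
  have "((\<lambda>c::real. 1 / sqrt (ln c)) \<longlongrightarrow> 0) at_top"
    by real_asymp
  from tendsto_mult[OF tendsto_mult[OF tendsto_const[of "\<bar>K\<bar>"] box_volume_asymp[OF assms]] this]
  have "\<forall>\<^sub>F c in at_top. \<bar>K\<bar> * (?u c / sqrt (ln c)) * (1 / sqrt (ln c)) < 1"
    by (rule order_tendstoD) simp
  moreover have "\<forall>\<^sub>F c::real in at_top. c > 1"
    by (rule eventually_gt_at_top)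
  ultimately show ?thesis
  proof eventually_elim
    case (elim c)
    have "\<bar>K\<bar> * ?u c < ln c"
      using elim by (simp add: field_simps)
    moreover have "K * (2 * real R + 1) ^ d \<le> \<bar>K\<bar> * ?u c"
      if "real R \<le> (\<alpha> * ln c) powr (1 / (2 * real d))" for R
      using that by (intro mult_mono power_mono) auto
    ultimately show ?case by force
  qed
qed

text \<open>
The logarithm of $(|A|^2+1)^B \cdot 2B \cdot (2(\rho+1)^{2d}+1) \cdot (\rho+1)^3$, where
$B = (2R+1)^d$ and $b = \ln(|A|^2+1)$. The first three factors bound the number of tests for the
radius \<open>R\<close> in the phase \<open>\<rho>\<close>, and the last one makes the failure probabilities summable.
\<close>
definition threshold :: "real \<Rightarrow> nat \<Rightarrow> nat \<Rightarrow> nat \<Rightarrow> real" where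
  "threshold b d \<rho> R = (2 * real R + 1) ^ d * b
     + ln (2 * (2 * real R + 1) ^ d * (2 * (real \<rho> + 1) ^ (2 * d) + 1) * (real \<rho> + 1) ^ 3)"

lemma threshold_pos:
  assumes "0 \<le> b"
  shows "0 < threshold b d \<rho> R"
proof -
  have 1: "1 \<le> (2 * real R + 1) ^ d" "1 \<le> 2 * (real \<rho> + 1) ^ (2 * d) + 1" "1 \<le> (real \<rho> + 1) ^ 3"
    by (auto intro: one_le_power)
  then have "1 \<le> (2 * real R + 1) ^ d * (2 * (real \<rho> + 1) ^ (2 * d) + 1) * (real \<rho> + 1) ^ 3"
    by (intro mult_ge1_I) auto
  then have "1 < 2 * (2 * real R + 1) ^ d * (2 * (real \<rho> + 1) ^ (2 * d) + 1) * (real \<rho> + 1) ^ 3"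
    by (simp add: mult.assoc)
  then show ?thesis
    unfolding threshold_def using assms 1(1) by (intro add_nonneg_pos mult_nonneg_nonneg ln_gt_zero) auto
qed

text \<open>
The first term of the threshold contributes $B^2 b$ to the product, which is asymptotic to
$4^d \alpha b \ln c$. The second is of order $\ln\ln c$, and $B$ times it is $o(\ln c)$.
\<close>
lemma eventually_threshold_le:
  fixes \<alpha> \<kappa> b :: real and d :: nat
  assumes \<alpha>: "0 < \<alpha>" "\<alpha> \<le> 1" and d: "0 < d" and b: "0 \<le> b" and \<kappa>: "4 ^ d * \<alpha> * b < \<kappa>"
  shows "\<forall>\<^sub>F c in at_top. \<forall>R \<rho> :: nat. real R \<le> (\<alpha> * ln c) powr (1 / (2 * real d)) \<longrightarrow>
           real \<rho> \<le> 1 + ln (2 * c) \<longrightarrow> (2 * real R + 1) ^ d * threshold b d \<rho> R \<le> \<kappa> * ln c"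
proof -
  let ?u = "\<lambda>c. (2 * (\<alpha> * ln c) powr (1 / (2 * real d)) + 1) ^ d"
  \<comment> \<open>?y bounds both \<rho> + 1 and R + 1; ?w is the resulting bound on the logarithm in the threshold.\<close>
  let ?y = "\<lambda>c::real. 2 + ln (2 * c)"
  let ?w = "\<lambda>c. ln 6 + real d * ln (3 * ?y c) + real (2 * d + 3) * ln (?y c)"
  have "((\<lambda>c. ?w c / sqrt (ln c)) \<longlongrightarrow> 0) at_top"
  proof -
    have "((\<lambda>c. ln 6 / sqrt (ln c) + real d * (ln (3 * ?y c) / sqrt (ln c))
        + real (2 * d + 3) * (ln (?y c) / sqrt (ln c))) \<longlongrightarrow> 0 + real d * 0 + real (2 * d + 3) * 0) at_top"
      by (intro tendsto_add tendsto_mult tendsto_const; real_asymp)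
    then show ?thesis by (simp add: add_divide_distrib)
  qed
  note w = this and u = box_volume_asymp[OF \<alpha>(1) d]
  have "((\<lambda>c. (?u c / sqrt (ln c)) ^ 2 * b + (?u c / sqrt (ln c)) * (?w c / sqrt (ln c)))
      \<longlongrightarrow> (2 ^ d * sqrt \<alpha>) ^ 2 * b + (2 ^ d * sqrt \<alpha>) * 0) at_top"
    by (intro tendsto_intros u w)
  also have "(2 ^ d * sqrt \<alpha>) ^ 2 * b + (2 ^ d * sqrt \<alpha>) * 0 = 4 ^ d * \<alpha> * b"
  proof -
    have "((2 :: real) ^ d) ^ 2 = 4 ^ d"
      by (simp add: power2_eq_square flip: power_mult_distrib)
    then show ?thesis
      using \<alpha> by (simp add: power_mult_distrib)
  qed
  finally have "\<forall>\<^sub>F c in at_top. (?u c / sqrt (ln c)) ^ 2 * b + (?u c / sqrt (ln c)) * (?w c / sqrt (ln c)) < \<kappa>"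
    using \<kappa> by (rule order_tendstoD)
  moreover have "\<forall>\<^sub>F c::real in at_top. c > 1"
    by (rule eventually_gt_at_top)
  ultimately show ?thesis
  proof eventually_elim
    case (elim c)
    let ?l = "ln c"
    have l: "?l > 0" and sq: "sqrt ?l * sqrt ?l = ?l"
      using elim by auto
    have y: "?y c \<ge> 2"
      using elim by simp
    have "?u c * (?u c * b + ?w c)
        = ((?u c / sqrt ?l) ^ 2 * b + (?u c / sqrt ?l) * (?w c / sqrt ?l)) * ?l"
      using l by (simp add: power2_eq_square field_simps)
    also have "\<dots> \<le> \<kappa> * ?l"
      using elim l by (intro mult_right_mono) auto
    finally have le: "?u c * (?u c * b + ?w c) \<le> \<kappa> * ?l" .
    show ?case
    proof (intro allI impI)
      fix R \<rho> :: nat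
      assume R: "real R \<le> (\<alpha> * ln c) powr (1 / (2 * real d))" and \<rho>: "real \<rho> \<le> 1 + ln (2 * c)"
      let ?B = "(2 * real R + 1) ^ d"
      have B1: "1 \<le> ?B"
        by (intro one_le_power) simp
      have Bu: "?B \<le> ?u c"
        using R by (intro power_mono) auto
      have "real R \<le> 1 + \<alpha> * ?l"
        using R powr_le_one_plus[of "\<alpha> * ?l" "1 / (2 * real d)"] \<alpha> l d by (simp add: field_simps)
      also have "\<alpha> * ?l \<le> 1 * ?l"
        using \<alpha> l by (intro mult_right_mono) auto
      also have "?l \<le> ln (2 * c)"
        using elim by simp
      finally have "2 * real R + 1 \<le> 3 * ?y c"
        using y by simp
      then have By: "?B \<le> (3 * ?y c) ^ d"
        by (intro power_mono) auto
      have \<rho>y: "real \<rho> + 1 \<le> ?y c"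
        using \<rho> by simp
      have "(real \<rho> + 1) ^ (2 * d) \<ge> 1"
        by (intro one_le_power) simp
      then have "2 * ?B * (2 * (real \<rho> + 1) ^ (2 * d) + 1) * (real \<rho> + 1) ^ 3
          \<le> 2 * ?B * (3 * (real \<rho> + 1) ^ (2 * d)) * (real \<rho> + 1) ^ 3"
        using B1 by (intro mult_right_mono mult_left_mono) auto
      also have "\<dots> = 6 * ?B * (real \<rho> + 1) ^ (2 * d + 3)"
        by (simp add: power_add)
      also have "\<dots> \<le> 6 * (3 * ?y c) ^ d * ?y c ^ (2 * d + 3)"
        using B1 \<rho>y y by (intro mult_mono power_mono[of "real \<rho> + 1"] order_refl By) auto
      finally have "ln (2 * ?B * (2 * (real \<rho> + 1) ^ (2 * d) + 1) * (real \<rho> + 1) ^ 3)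
          \<le> ln (6 * (3 * ?y c) ^ d * ?y c ^ (2 * d + 3))"
        using B1 y by (intro ln_mono) (auto intro!: mult_pos_pos add_nonneg_pos)
      also have "\<dots> = ?w c"
        using y by (simp add: ln_mult ln_realpow)
      finally have "threshold b d \<rho> R \<le> ?u c * b + ?w c"
        unfolding threshold_def using Bu b by (intro add_mono mult_right_mono) auto
      moreover have "0 \<le> threshold b d \<rho> R"
        using threshold_pos[OF b] by (rule less_imp_le)
      ultimately have "?B * threshold b d \<rho> R \<le> ?u c * (?u c * b + ?w c)"
        using Bu B1 by (intro mult_mono) auto
      with le show "?B * threshold b d \<rho> R \<le> \<kappa> * ln c"
        by simp
    qed
  qed
qed

text \<open>
For a volume $B = O(\sqrt{\ln c})$ the quantities $q^B$, $A^B$ and $B$ are all $c^{o(1)}$. Hence a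
class of $c/B$ sites still has many expected occurrences of every block, and a union over the
$A^B$ blocks of the box is affordable.
\<close>
lemma eventually_occurrence_estimates:
  fixes \<alpha> q A :: real and d :: nat
  assumes "0 < \<alpha>" "0 < d" and q: "0 < q" "q \<le> 1" and A: "1 \<le> A"
  shows "\<forall>\<^sub>F c in at_top. \<forall>R::nat. real R \<le> (\<alpha> * ln c) powr (1 / (2 * real d)) \<longrightarrow>
           sqrt c \<le> q ^ ((2 * R + 1) ^ d) * c / (4 * (2 * real R + 1) ^ d) \<and>
           A ^ ((2 * R + 1) ^ d) * exp (- sqrt c) \<le> 1 / c\<^sup>2"
proof -
  define K where "K = 2 * (ln (1 / q) + 4) + 4 * ln A"
  have q': "0 \<le> ln (1 / q)" and A': "0 \<le> ln A"
    using q A by auto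
  have "\<forall>\<^sub>F c::real in at_top. exp (- (sqrt c / 2)) \<le> 1 / c\<^sup>2"
    by real_asymp
  moreover have "\<forall>\<^sub>F c::real in at_top. c > 1"
    by (rule eventually_gt_at_top)
  moreover note eventually_box_volume_le_ln[OF assms(1,2), of K]
  ultimately show ?thesis
  proof eventually_elim
    case (elim c)
    show ?case
    proof (intro allI impI)
      fix R :: nat assume R: "real R \<le> (\<alpha> * ln c) powr (1 / (2 * real d))"
      define B where "B = (2 * R + 1) ^ d"
      have B: "real B = (2 * real R + 1) ^ d" "1 \<le> real B"
        unfolding B_def by (simp_all add: add.commute)
      have KB: "K * real B \<le> ln c"
        using elim R by (simp add: B)
      have "2 * (ln (1 / q) + 4) * real B \<le> K * real B" "4 * ln A * real B \<le> K * real B"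
        using q' A' B by (intro mult_right_mono; simp add: K_def)+
      with KB have 1: "real B * ln (1 / q) + 4 * real B \<le> ln c / 2" and 2: "real B * ln A \<le> ln c / 4"
        by (simp_all add: algebra_simps)
      have sqrt: "sqrt c = exp (ln c / 2)"
        using elim by (simp add: ln_sqrt[symmetric])
      have "4 * real B \<le> exp (4 * real B)"
        using exp_ge_add_one_self[of "4 * real B"] by linarith
      then have "sqrt c * (4 * real B) \<le> exp (ln c / 2) * exp (4 * real B)"
        unfolding sqrt by (intro mult_left_mono) simp_all
      also have "\<dots> \<le> exp (ln c - real B * ln (1 / q))"
        using 1 by (simp flip: exp_add)
      also have "\<dots> = q ^ B * c"
        using elim q by (simp add: exp_diff exp_add ln_div exp_minus field_simps exp_of_nat_mult)
      finally have "sqrt c \<le> q ^ B * c / (4 * real B)"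
        using B(2) by (simp add: field_simps)
      moreover have "A ^ B * exp (- sqrt c) \<le> 1 / c\<^sup>2"
      proof -
        have "ln (sqrt c) \<le> sqrt c"
          using elim ln_le_minus_one[of "sqrt c"] by simp
        then have "real B * ln A \<le> sqrt c / 2"
          using 2 elim by (simp add: ln_sqrt)
        moreover have "A ^ B = exp (real B * ln A)"
          using A by (simp add: exp_of_nat_mult)
        ultimately have "A ^ B * exp (- sqrt c) \<le> exp (sqrt c / 2) * exp (- sqrt c)"
          by (intro mult_right_mono) auto
        also have "\<dots> = exp (- (sqrt c / 2))"
          by (simp flip: exp_add)
        finally show ?thesis
          using elim by simp
      qed
      ultimately show "sqrt c \<le> q ^ ((2 * R + 1) ^ d) * c / (4 * (2 * real R + 1) ^ d) \<and>
           A ^ ((2 * R + 1) ^ d) * exp (- sqrt c) \<le> 1 / c\<^sup>2"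
        unfolding B_def[symmetric] B(1) [symmetric] by simp
    qed
  qed
qed


section \<open>Phases of the core\<close>

definition core_radius :: "(int ^ 'd::finite) set \<Rightarrow> real" where
  "core_radius \<Lambda> = ln (real (card \<Lambda>)) powr (1 / (2 * real CARD('d)))"

text \<open>
The integer part of the radius that defines the core. Only it matters, because the norm takes
integer values. Although the core is not monotone in the sample region, it is monotone among the
regions of one phase, and this is what the maximal inequality needs.
\<close>
definition phase :: "(int ^ 'd::finite) set \<Rightarrow> nat" where
  "phase \<Lambda> = nat \<lfloor>core_radius \<Lambda>\<rfloor>"

lemma phase_le: "real (phase \<Lambda>) \<le> core_radius \<Lambda>"
  and phase_gt: "core_radius \<Lambda> < real (phase \<Lambda>) + 1"
  and le_phase_iff: "real_of_int m \<le> core_radius \<Lambda> \<longleftrightarrow> m \<le> int (phase \<Lambda>)"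
proof -
  have "0 \<le> core_radius \<Lambda>"
    by (simp add: core_radius_def)
  then have "int (phase \<Lambda>) = \<lfloor>core_radius \<Lambda>\<rfloor>"
    by (simp add: phase_def)
  then show "real (phase \<Lambda>) \<le> core_radius \<Lambda>" "core_radius \<Lambda> < real (phase \<Lambda>) + 1"
    "real_of_int m \<le> core_radius \<Lambda> \<longleftrightarrow> m \<le> int (phase \<Lambda>)"
    by (simp_all add: le_floor_iff) linarith+
qed

lemma core_eq: "core \<Lambda> = {i \<in> \<Lambda>. \<forall>j. maxnorm (i - j) \<le> int (phase \<Lambda>) \<longrightarrow> j \<in> \<Lambda>}"
  unfolding core_def core_radius_def[symmetric] le_phase_iff by blast

lemma core_subset: "core \<Lambda> \<subseteq> \<Lambda>"
  by (auto simp: core_def)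

lemma core_mono_in_phase: "\<Lambda> \<subseteq> \<Lambda>' \<Longrightarrow> phase \<Lambda> = phase \<Lambda>' \<Longrightarrow> core \<Lambda> \<subseteq> core \<Lambda>'"
  unfolding core_eq by auto

lemma translate_subset_of_core:
  assumes "i \<in> core \<Lambda>" "\<Gamma> \<subseteq> box R" "R \<le> phase \<Lambda>"
  shows "translate \<Gamma> i \<subseteq> \<Lambda>"
proof -
  have "i + v \<in> \<Lambda>" if "v \<in> \<Gamma>" for v
  proof -
    have "maxnorm v \<le> int R"
      using assms(2) that by (auto simp: in_box_iff_maxnorm)
    then have "maxnorm v \<le> int (phase \<Lambda>)"
      using assms(3) by linarith
    then have "maxnorm (i - (i + v)) \<le> int (phase \<Lambda>)"
      by (simp add: maxnorm_def)
    then show ?thesis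
      using assms(1) unfolding core_eq by blast
  qed
  then show ?thesis by (auto simp: translate_def)
qed

lemma count_nbhd_eq_sum:
  assumes "finite \<Lambda>" "\<Gamma> \<subseteq> box R" "R \<le> phase \<Lambda>"
  shows "real (count_nbhd \<Lambda> x \<Gamma> a) = (\<Sum>i\<in>core \<Lambda>. occurs \<Gamma> a i x)"
proof -
  have "{i \<in> core \<Lambda>. translate \<Gamma> i \<subseteq> \<Lambda> \<and> (\<forall>j\<in>\<Gamma>. x (i + j) = a j)}
      = core \<Lambda> \<inter> {i. \<forall>j\<in>\<Gamma>. x (i + j) = a j}"
    using translate_subset_of_core[OF _ assms(2,3)] by blast
  then show ?thesis
    using finite_subset[OF core_subset assms(1)]
    by (simp add: count_nbhd_def occurs_def sum_of_bool_eq)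
qed

lemma count_nbhd_site_eq_sum:
  assumes "finite \<Lambda>" "\<Gamma> \<subseteq> box R" "R \<le> phase \<Lambda>"
  shows "real (count_nbhd_site \<Lambda> x \<Gamma> a) = (\<Sum>i\<in>core \<Lambda>. occurs \<Gamma> a i x * of_bool (x i = a 0))"
proof -
  have "{i \<in> core \<Lambda>. translate \<Gamma> i \<subseteq> \<Lambda> \<and> (\<forall>j\<in>\<Gamma> \<union> {0}. x (i + j) = a j)}
      = core \<Lambda> \<inter> {i. (\<forall>j\<in>\<Gamma>. x (i + j) = a j) \<and> x i = a 0}"
    using translate_subset_of_core[OF _ assms(2,3)] by auto
  then show ?thesis
    using finite_subset[OF core_subset assms(1)]
    by (simp add: count_nbhd_site_def occurs_def sum_of_bool_eq flip: of_bool_conj)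
qed

lemma ln_card_less_phase:
  fixes \<Lambda> :: "(int ^ 'd::finite) set"
  assumes "0 < card \<Lambda>"
  shows "ln (real (card \<Lambda>)) < (real (phase \<Lambda>) + 1) ^ (2 * CARD('d))"
proof -
  have ln: "0 \<le> ln (real (card \<Lambda>))"
    using assms by simp
  have "core_radius \<Lambda> ^ (2 * CARD('d)) = ln (real (card \<Lambda>))"
  proof (cases "ln (real (card \<Lambda>)) = 0")
    case False
    with ln have "0 < core_radius \<Lambda>"
      by (simp add: core_radius_def)
    then have "core_radius \<Lambda> ^ (2 * CARD('d)) = core_radius \<Lambda> powr real (2 * CARD('d))"
      by (rule powr_realpow[symmetric])
    with ln show ?thesis
      by (simp add: core_radius_def powr_powr)
  qed (simp add: core_radius_def)
  moreover have "core_radius \<Lambda> ^ (2 * CARD('d)) < (real (phase \<Lambda>) + 1) ^ (2 * CARD('d))"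
    by (intro power_strict_mono phase_gt) (auto simp: core_radius_def)
  ultimately show ?thesis by simp
qed

section \<open>The deviation tests of one phase\<close>

text \<open>
The exponential rate $\lambda$ of a test designed for counts of order $2^j$. Here \<open>v\<close> is $BL$ and
the rate balances the two terms of $BL/\lambda + \lambda N/8$ at $N = 2^j$.
\<close>
definition rate :: "real \<Rightarrow> nat \<Rightarrow> real" where
  "rate v j = sqrt (8 * v / 2 ^ j)"

text \<open>
The level of the tests is a parameter of the locale because its type does not mention the
cardinalities of the state space and of the index type on which it depends.
\<close>
locale sampled_field = positive_field M X
  for M :: "'w measure" and X :: "int ^ 'd::finite \<Rightarrow> 'w \<Rightarrow> 'a::finite" +
  fixes \<Lambda> :: "nat \<Rightarrow> (int ^ 'd) set"
  assumes finite_\<Lambda>: "n \<ge> 1 \<Longrightarrow> finite (\<Lambda> n)"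
    and \<Lambda>_Suc: "n \<ge> 1 \<Longrightarrow> \<Lambda> n \<subset> \<Lambda> (Suc n)"
  fixes level :: "nat \<Rightarrow> nat \<Rightarrow> real"
  defines level_def: "level \<equiv> threshold (ln ((real CARD('a))\<^sup>2 + 1)) CARD('d)"
begin

lemma \<Lambda>_mono:
  assumes "1 \<le> m" "m \<le> n"
  shows "\<Lambda> m \<subseteq> \<Lambda> n"
  using assms(2)
proof (induction n rule: dec_induct)
  case (step n)
  then show ?case
    using \<Lambda>_Suc[of n] assms(1) by auto
qed simp

lemma card_\<Lambda>_ge: "1 \<le> n \<Longrightarrow> n \<le> card (\<Lambda> n) + 1"
proof (induction n rule: dec_induct[of 1])
  case (step n)
  have "card (\<Lambda> n) < card (\<Lambda> (Suc n))"
    using step \<Lambda>_Suc finite_\<Lambda> by (intro psubset_card_mono) auto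
  with step show ?case by linarith
qed auto

text \<open>
The part of the core at time \<open>t\<close> in one residue class, as long as the phase is \<open>\<rho>\<close>. The union over
earlier times makes it increasing for all \<open>t\<close>; at times in the phase it adds nothing.
\<close>
definition stage :: "nat \<Rightarrow> nat \<Rightarrow> int ^ 'd \<Rightarrow> nat \<Rightarrow> (int ^ 'd) set" where
  "stage \<rho> R k t = {i. residue (2 * R + 1) i = k \<and> (\<exists>n\<in>{1..t}. phase (\<Lambda> n) = \<rho> \<and> i \<in> core (\<Lambda> n))}"

lemma finite_stage: "finite (stage \<rho> R k t)"
proof (rule finite_subset)
  show "stage \<rho> R k t \<subseteq> (\<Union>n\<in>{1..t}. \<Lambda> n)"
    using core_subset by (auto simp: stage_def)
qed (auto simp: finite_\<Lambda>)

lemma incseq_stage: "incseq (stage \<rho> R k)"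
  unfolding stage_def by (rule incseq_SucI) force

lemma stage_eq:
  assumes "1 \<le> n" "phase (\<Lambda> n) = \<rho>"
  shows "stage \<rho> R k n = {i \<in> core (\<Lambda> n). residue (2 * R + 1) i = k}"
proof -
  have "i \<in> core (\<Lambda> n)" if "m \<in> {1..n}" "phase (\<Lambda> m) = \<rho>" "i \<in> core (\<Lambda> m)" for m i
    using core_mono_in_phase[of "\<Lambda> m" "\<Lambda> n"] \<Lambda>_mono[of m n] that assms by auto
  then show ?thesis
    using assms unfolding stage_def by (intro Collect_cong) fastforce
qed

lemma stage_separated:
  assumes "i \<in> stage \<rho> R k t" "\<Gamma> \<subseteq> box R" "0 \<notin> \<Gamma>"
  shows "translate \<Gamma> i \<inter> stage \<rho> R k t = {}"
proof -
  have False if "v \<in> \<Gamma>" "i + v \<in> stage \<rho> R k t" for v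
  proof -
    have "i = i + v"
      using that assms by (intro same_residue_boxes_meet[of R i "i + v" v 0]) (auto simp: stage_def)
    with that assms(3) show False by simp
  qed
  then show ?thesis by (auto simp: translate_def)
qed

text \<open>
A test for the phase \<open>\<rho>\<close> and the radius \<open>R\<close> consists of a neighborhood, a block on the whole box, a
residue class, a sign for the two directions of a deviation, and the dyadic order of magnitude
of the count. A count in phase \<open>\<rho>\<close> is below $\exp((\rho+1)^{2d})$, which bounds its order of
magnitude by $2(\rho+1)^{2d}$.
\<close>
definition tests ::
    "nat \<Rightarrow> nat \<Rightarrow> ((int ^ 'd) set \<times> (int ^ 'd \<Rightarrow> 'a) \<times> (int ^ 'd) \<times> real \<times> nat) set" where
  "tests \<rho> R = {\<Gamma> \<in> Pow (box R). Markov_neighborhood M X \<Gamma>} \<times> (box R \<rightarrow>\<^sub>E UNIV)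
     \<times> residues (2 * R + 1) \<times> {1, - 1} \<times> {..2 * (\<rho> + 1) ^ (2 * CARD('d))}"

definition test_event where
  "test_event \<rho> R = (\<lambda>(\<Gamma>, a, k, \<sigma>, j).
     deviation_event (\<sigma> * rate ((2 * real R + 1) ^ CARD('d) * level \<rho> R) j) (level \<rho> R) \<Gamma> a (stage \<rho> R k))"

definition deviating :: "nat \<Rightarrow> 'w set" where
  "deviating \<rho> = (\<Union>R\<le>\<rho>. \<Union>\<tau>\<in>tests \<rho> R. test_event \<rho> R \<tau>)"

lemma finite_tests: "finite (tests \<rho> R)"
  unfolding tests_def by (intro finite_cartesian_product finite_PiE) auto

text \<open>
There are at most $2^B$ neighborhoods and $|A|^B$ blocks, and $(2|A|)^B \le (|A|^2+1)^B$; this is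
where $\ln(|A|^2+1)$ enters.
\<close>
lemma card_tests_le:
  "real (card (tests \<rho> R)) * exp (- level \<rho> R) \<le> 1 / (real \<rho> + 1) ^ 3"
proof -
  let ?B = "(2 * R + 1) ^ CARD('d)" and ?A = "real CARD('a)"
  let ?J = "2 * (\<rho> + 1) ^ (2 * CARD('d)) + 1"
  have "card {\<Gamma> \<in> Pow (box R). Markov_neighborhood M X \<Gamma>} \<le> card (Pow (box R :: (int ^ 'd) set))"
    by (intro card_mono) auto
  also have "\<dots> = 2 ^ ?B"
    by (simp add: card_Pow card_box)
  finally have "card (tests \<rho> R) \<le> 2 ^ ?B * (CARD('a) ^ ?B * (?B * (2 * ?J)))"
    unfolding tests_def card_cartesian_product
    by (intro mult_mono) (auto simp: card_PiE card_box card_residues)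
  then have "real (card (tests \<rho> R)) \<le> real (2 ^ ?B * (CARD('a) ^ ?B * (?B * (2 * ?J))))"
    by (rule of_nat_mono)
  also have "\<dots> = (2 * ?A) ^ ?B * (2 * real ?B * real ?J)"
    by (simp only: of_nat_mult of_nat_power of_nat_numeral power_mult_distrib mult_ac)
  also have "\<dots> \<le> (?A\<^sup>2 + 1) ^ ?B * (2 * real ?B * real ?J)"
    using sum_squares_bound[of ?A 1] by (intro mult_right_mono power_mono) auto
  finally have card: "real (card (tests \<rho> R)) \<le> (?A\<^sup>2 + 1) ^ ?B * (2 * real ?B * real ?J)" .
  have "exp (level \<rho> R) = (?A\<^sup>2 + 1) ^ ?B * (2 * real ?B * real ?J * (real \<rho> + 1) ^ 3)"
  proof -
    have "exp (real ?B * ln (?A\<^sup>2 + 1)) = (?A\<^sup>2 + 1) ^ ?B"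
      by (subst exp_of_nat_mult) (simp add: add_pos_pos)
    moreover have "0 < 2 * real ?B * real ?J * (real \<rho> + 1) ^ 3"
      by (intro mult_pos_pos) (auto intro!: add_pos_nonneg)
    moreover have "real ?B = (2 * real R + 1) ^ CARD('d)"
      "real ?J = 2 * (real \<rho> + 1) ^ (2 * CARD('d)) + 1"
      by (simp_all add: add.commute)
    ultimately show ?thesis
      unfolding level_def threshold_def exp_add by (simp only: exp_ln)
  qed
  moreover define P where "P = (?A\<^sup>2 + 1) ^ ?B * (2 * real ?B * real ?J)"
  ultimately have exp: "exp (- level \<rho> R) = 1 / (P * (real \<rho> + 1) ^ 3)"
    by (simp only: exp_minus inverse_eq_divide mult.assoc)
  have "0 < P"
    unfolding P_def by (intro mult_pos_pos zero_less_power add_nonneg_pos) (auto intro!: add_pos_nonneg)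
  then have "real (card (tests \<rho> R)) / P \<le> 1"
    using card by (simp add: P_def)
  then have "real (card (tests \<rho> R)) / P * (1 / (real \<rho> + 1) ^ 3) \<le> 1 * (1 / (real \<rho> + 1) ^ 3)"
    by (intro mult_right_mono) auto
  then show ?thesis
    by (simp add: exp)
qed

lemma test_event:
  assumes "\<tau> \<in> tests \<rho> R"
  shows "test_event \<rho> R \<tau> \<in> events" "prob (test_event \<rho> R \<tau>) \<le> exp (- level \<rho> R)"
proof -
  obtain \<Gamma> a k \<sigma> j where \<tau>: "\<tau> = (\<Gamma>, a, k, \<sigma>, j)"
    by (cases \<tau>)
  have \<Gamma>: "\<Gamma> \<subseteq> box R" "Markov_neighborhood M X \<Gamma>"
    using assms by (auto simp: tests_def \<tau>)
  note dev = prob_deviation_event_le[OF \<Gamma>(2) incseq_stage finite_stage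
      stage_separated[OF _ \<Gamma>(1) Markov_neighborhoodD(2)[OF \<Gamma>(2)]]]
  show "test_event \<rho> R \<tau> \<in> events" "prob (test_event \<rho> R \<tau>) \<le> exp (- level \<rho> R)"
    unfolding test_event_def \<tau> prod.case by (rule dev; assumption)+
qed

lemma deviating_event: "deviating \<rho> \<in> events"
  unfolding deviating_def by (intro sets.finite_UN finite_tests test_event finite_atMost)

text \<open>
The union over the $\rho+1$ radii costs one power of $\rho+1$. The bound is summable over the
phases, while it would not be summable over \<open>n\<close>.
\<close>
lemma prob_deviating_le: "prob (deviating \<rho>) \<le> 1 / (real \<rho> + 1) ^ 2"
proof -
  have "prob (deviating \<rho>) \<le> (\<Sum>R\<le>\<rho>. prob (\<Union>\<tau>\<in>tests \<rho> R. test_event \<rho> R \<tau>))"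
    unfolding deviating_def
    by (intro finite_measure_subadditive_finite)
       (auto intro!: sets.finite_UN finite_tests test_event)
  also have "\<dots> \<le> (\<Sum>R\<le>\<rho>. 1 / (real \<rho> + 1) ^ 3)"
  proof (rule sum_mono)
    fix R
    have "prob (\<Union>\<tau>\<in>tests \<rho> R. test_event \<rho> R \<tau>) \<le> (\<Sum>\<tau>\<in>tests \<rho> R. prob (test_event \<rho> R \<tau>))"
      by (intro finite_measure_subadditive_finite finite_tests) (auto intro: test_event)
    also have "\<dots> \<le> (\<Sum>\<tau>\<in>tests \<rho> R. exp (- level \<rho> R))"
      by (intro sum_mono test_event)
    also have "\<dots> \<le> 1 / (real \<rho> + 1) ^ 3"
      using card_tests_le by simp
    finally show "prob (\<Union>\<tau>\<in>tests \<rho> R. test_event \<rho> R \<tau>) \<le> 1 / (real \<rho> + 1) ^ 3" .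
  qed
  also have "\<dots> = 1 / (real \<rho> + 1) ^ 2"
    by (simp add: power3_eq_cube power2_eq_square add.commute)
  finally show ?thesis .
qed

lemma AE_eventually_not_deviating: "AE \<omega> in M. \<forall>\<^sub>F \<rho> in sequentially. \<omega> \<notin> deviating \<rho>"
proof -
  have "summable (\<lambda>\<rho>. 1 / (real \<rho> + 1) ^ 2)"
  proof -
    have "summable (\<lambda>\<rho>. inverse (real (Suc \<rho>) ^ 2))"
      using inverse_power_summable[of 2, where 'a = real] by (subst summable_Suc_iff) simp
    then show ?thesis by (simp add: inverse_eq_divide add.commute)
  qed
  then have "summable (\<lambda>\<rho>. prob (deviating \<rho>))"
    by (rule summable_comparison_test'[where N = 0]) (use prob_deviating_le in simp)
  then have "AE \<omega> in M. \<forall>\<^sub>F \<rho> in sequentially. \<omega> \<in> space M - deviating \<rho>"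
    by (intro borel_cantelli_AE1 deviating_event) (auto simp: emeasure_eq_measure)
  then show ?thesis
    by eventually_elim (auto elim: eventually_mono)
qed

text \<open>
Adding the inequalities $\pm\lambda S_k - \lambda^2 N_k/8 < L$ over the $B$ residue classes gives
$|S| \le BL/\lambda + \lambda N/8$. The same $\lambda$ serves all classes, however unevenly the
occurrences are spread, and choosing it for the dyadic scale of $N$ yields $S^2 \le BLN$.
\<close>
lemma count_deviation_square_le:
  fixes a :: "int ^ 'd \<Rightarrow> 'a"
  assumes \<omega>: "\<omega> \<in> space M" "\<omega> \<notin> deviating (phase (\<Lambda> n))"
    and n: "1 \<le> n" and R: "R \<le> phase (\<Lambda> n)"
    and \<Gamma>: "\<Gamma> \<subseteq> box R" "Markov_neighborhood M X \<Gamma>"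
  defines "N \<equiv> real (count_nbhd (\<Lambda> n) (conf \<omega>) \<Gamma> a)"
    and "N0 \<equiv> real (count_nbhd_site (\<Lambda> n) (conf \<omega>) \<Gamma> a)"
  assumes N_pos: "0 < N"
  shows "(N0 - N * block_cond_prob M X {0} \<Gamma> a)\<^sup>2
       \<le> (2 * real R + 1) ^ CARD('d) * level (phase (\<Lambda> n)) R * N"
proof -
  define \<rho> where "\<rho> = phase (\<Lambda> n)"
  define BL where "BL = (2 * real R + 1) ^ CARD('d) * level \<rho> R"
  define S where "S = (\<Sum>i\<in>core (\<Lambda> n). innovation \<Gamma> a i (conf \<omega>))"
  have fin: "finite (\<Lambda> n)" "finite (core (\<Lambda> n))"
    using finite_\<Lambda>[OF n] finite_subset[OF core_subset] by auto
  have N: "N = (\<Sum>i\<in>core (\<Lambda> n). occurs \<Gamma> a i (conf \<omega>))"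
    unfolding N_def by (rule count_nbhd_eq_sum[OF fin(1) \<Gamma>(1) R])
  have S: "S = N0 - N * block_cond_prob M X {0} \<Gamma> a"
    unfolding S_def N N0_def count_nbhd_site_eq_sum[OF fin(1) \<Gamma>(1) R] innovation_def
    by (simp add: right_diff_distrib sum_subtractf sum_distrib_right)
  have BL: "0 < BL"
    unfolding BL_def level_def by (intro mult_pos_pos threshold_pos) auto
  obtain j where j: "2 ^ j \<le> N" "N < 2 ^ (j + 1)" and j_le: "j \<le> 2 * (\<rho> + 1) ^ (2 * CARD('d))"
  proof -
    let ?N = "count_nbhd (\<Lambda> n) (conf \<omega>) \<Gamma> a"
    have "1 \<le> ?N"
      using N_pos by (simp add: N_def)
    then obtain j where j: "2 ^ j \<le> ?N" "?N < 2 ^ (j + 1)"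
      using ex_power_ivl1[of 2 ?N] by auto
    have "?N \<le> card (\<Lambda> n)"
      unfolding count_nbhd_def using fin core_subset by (intro card_mono) auto
    with j(1) have "2 ^ j \<le> card (\<Lambda> n)"
      by linarith
    then have le: "2 ^ j \<le> real (card (\<Lambda> n))" and card: "0 < card (\<Lambda> n)"
      using of_nat_mono[of "2 ^ j" "card (\<Lambda> n)", where 'a = real] by (auto intro: gr0I)
    have "real j * ln 2 = ln (2 ^ j)"
      by (simp add: ln_realpow)
    also have "\<dots> \<le> ln (real (card (\<Lambda> n)))"
      using le by (intro ln_mono) auto
    also have "\<dots> < (real \<rho> + 1) ^ (2 * CARD('d))"
      unfolding \<rho>_def by (rule ln_card_less_phase[OF card])
    finally have "real j * ln 2 < (real \<rho> + 1) ^ (2 * CARD('d))" .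
    moreover have "real j * (1 / 2) \<le> real j * ln 2"
      using ln_le_minus_one[of "1 / 2 :: real"] by (intro mult_left_mono) (auto simp: ln_div)
    ultimately have "real j \<le> real (2 * (\<rho> + 1) ^ (2 * CARD('d)))"
      by (simp add: add.commute)
    then have "j \<le> 2 * (\<rho> + 1) ^ (2 * CARD('d))"
      by (simp only: of_nat_le_iff)
    moreover have "real (2 ^ j) \<le> real ?N" "real ?N < real (2 ^ (j + 1))"
      using j by (simp_all only: of_nat_le_iff of_nat_less_iff)
    then have "2 ^ j \<le> N" "N < 2 ^ (j + 1)"
      by (simp_all add: N_def)
    ultimately show ?thesis using that by blast
  qed
  define l where "l = rate BL j"
  have l2: "l\<^sup>2 = 8 * BL / 2 ^ j" and l: "0 < l"
    using BL by (auto simp: l_def rate_def)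
  have signed: "\<sigma> * l * S - l\<^sup>2 / 8 * N \<le> BL" if \<sigma>: "\<sigma> \<in> {1, - 1}" for \<sigma>
  proof -
    let ?cl = "\<lambda>k. {i \<in> core (\<Lambda> n). residue (2 * R + 1) i = k}"
    have part: "(\<Sum>i\<in>core (\<Lambda> n). f i) = (\<Sum>k\<in>residues (2 * R + 1). \<Sum>i\<in>?cl k. f i)" for f :: "int ^ 'd \<Rightarrow> real"
      using residue_in_residues[of "2 * R + 1"] fin
      by (intro sum.group[symmetric]) auto
    have le: "\<sigma> * l * (\<Sum>i\<in>?cl k. innovation \<Gamma> a i (conf \<omega>))
        - l\<^sup>2 / 8 * (\<Sum>i\<in>?cl k. occurs \<Gamma> a i (conf \<omega>)) \<le> level \<rho> R"
      if k: "k \<in> residues (2 * R + 1)" for k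
    proof -
      let ?a = "restrict a (box R)"
      let ?\<tau> = "(\<Gamma>, ?a, k, \<sigma>, j)"
      have "?\<tau> \<in> tests \<rho> R"
        using \<Gamma> k \<sigma> j_le by (auto simp: tests_def)
      then have "\<omega> \<notin> test_event \<rho> R ?\<tau>"
        using \<omega>(2) R unfolding deviating_def \<rho>_def by blast
      then have "\<not> level \<rho> R \<le> \<sigma> * l * (\<Sum>i\<in>stage \<rho> R k n. innovation \<Gamma> ?a i (conf \<omega>))
          - (\<sigma> * l)\<^sup>2 / 8 * (\<Sum>i\<in>stage \<rho> R k n. occurs \<Gamma> ?a i (conf \<omega>))"
        using \<omega>(1) unfolding test_event_def prod.case deviation_event_def l_def BL_def by blast
      moreover have "stage \<rho> R k n = ?cl k"
        using n \<rho>_def by (intro stage_eq) auto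
      moreover have occ: "occurs \<Gamma> ?a i x = occurs \<Gamma> a i x" for i x
        using \<Gamma>(1) unfolding occurs_def by (intro arg_cong[where f = of_bool] ball_cong) auto
      moreover have "innovation \<Gamma> ?a i x = innovation \<Gamma> a i x" for i x
      proof -
        have "block_cond_prob M X {0} \<Gamma> ?a = block_cond_prob M X {0} \<Gamma> a"
          using \<Gamma>(1) by (intro block_cond_prob_cong) auto
        then show ?thesis
          by (simp add: innovation_def occ)
      qed
      moreover have "(\<sigma> * l)\<^sup>2 = l\<^sup>2"
        using \<sigma> by auto
      ultimately show ?thesis by simp
    qed
    have "\<sigma> * l * S - l\<^sup>2 / 8 * N = (\<Sum>k\<in>residues (2 * R + 1).
        \<sigma> * l * (\<Sum>i\<in>?cl k. innovation \<Gamma> a i (conf \<omega>))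
        - l\<^sup>2 / 8 * (\<Sum>i\<in>?cl k. occurs \<Gamma> a i (conf \<omega>)))"
      unfolding S_def N by (simp only: part sum_subtractf sum_distrib_left)
    also have "\<dots> \<le> (\<Sum>k\<in>(residues (2 * R + 1) :: (int ^ 'd) set). level \<rho> R)"
      by (intro sum_mono le)
    also have "\<dots> = BL"
      by (simp add: BL_def card_residues add.commute)
    finally show ?thesis .
  qed
  have "l * \<bar>S\<bar> \<le> BL + l\<^sup>2 / 8 * N"
    using signed[of 1] signed[of "- 1"] l by (cases "0 \<le> S") auto
  also have "BL = l\<^sup>2 / 8 * 2 ^ j"
    by (simp add: l2)
  also have "l\<^sup>2 / 8 * 2 ^ j + l\<^sup>2 / 8 * N \<le> l\<^sup>2 / 8 * N + l\<^sup>2 / 8 * N"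
    using j(1) by (intro add_right_mono mult_left_mono) auto
  also have "\<dots> = l * (l * N / 4)"
    by (simp add: power2_eq_square)
  finally have "\<bar>S\<bar> \<le> l * N / 4"
    using l by simp
  then have "\<bar>S\<bar>\<^sup>2 \<le> (l * N / 4)\<^sup>2"
    by (intro power_mono) auto
  also have "\<dots> = l\<^sup>2 * N * N / 16"
    by (simp add: power2_eq_square)
  also have "\<dots> \<le> l\<^sup>2 * N * (2 * 2 ^ j) / 16"
    using j(2) N_pos by (intro divide_right_mono mult_left_mono) auto
  also have "\<dots> = BL * N"
    by (simp add: l2)
  finally show ?thesis
    by (simp add: S BL_def \<rho>_def)
qed

end


section \<open>Growth of the sample and the lower bound on the counts\<close>

context sampled_field
begin

text \<open>
The regions grow strictly, so $|\Lambda_n| \ge n - 1$, and the core has eventually at least half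
the size of its region.
\<close>
lemma core_card_growth:
  assumes lim: "(\<lambda>n. real (card (\<Lambda> n)) / real (card (core (\<Lambda> n)))) \<longlonglongrightarrow> 1"
  shows "\<forall>\<^sub>F n in sequentially. real (card (\<Lambda> n)) \<le> 2 * real (card (core (\<Lambda> n)))"
    and "\<forall>\<^sub>F n in sequentially. real n \<le> 4 * real (card (core (\<Lambda> n)))"
    and "filterlim (\<lambda>n. real (card (core (\<Lambda> n)))) at_top sequentially"
proof -
  let ?r = "\<lambda>n. real (card (\<Lambda> n)) / real (card (core (\<Lambda> n)))"
  have "\<forall>\<^sub>F n in sequentially. ?r n < 2" "\<forall>\<^sub>F n in sequentially. 0 < ?r n"
    using lim by (auto intro: order_tendstoD)
  then show le: "\<forall>\<^sub>F n in sequentially. real (card (\<Lambda> n)) \<le> 2 * real (card (core (\<Lambda> n)))"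
  proof eventually_elim
    case (elim n)
    then have "0 < real (card (core (\<Lambda> n)))"
      by (cases "card (core (\<Lambda> n)) = 0") auto
    with elim show ?case by (simp add: field_simps)
  qed
  from le eventually_ge_at_top[of 2]
  show le': "\<forall>\<^sub>F n in sequentially. real n \<le> 4 * real (card (core (\<Lambda> n)))"
  proof eventually_elim
    case (elim n)
    with card_\<Lambda>_ge[of n] show ?case by linarith
  qed
  have "filterlim (\<lambda>n. real n / 4) at_top sequentially"
    by real_asymp
  then show "filterlim (\<lambda>n. real (card (core (\<Lambda> n)))) at_top sequentially"
    by (rule filterlim_at_top_mono) (use le' in \<open>auto elim: eventually_mono\<close>)
qed

lemma phase_at_top:
  assumes "(\<lambda>n. real (card (\<Lambda> n)) / real (card (core (\<Lambda> n)))) \<longlonglongrightarrow> 1"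
  shows "filterlim (\<lambda>n. phase (\<Lambda> n)) at_top sequentially"
proof -
  have "filterlim (\<lambda>n. real (card (\<Lambda> n))) at_top sequentially"
    by (rule filterlim_at_top_mono[OF core_card_growth(3)[OF assms]])
       (auto intro!: eventually_sequentiallyI[of 1] card_mono core_subset finite_\<Lambda>)
  moreover have "0 < 1 / (2 * real CARD('d))"
    by simp
  then have "filterlim (\<lambda>c::real. ln c powr (1 / (2 * real CARD('d)))) at_top at_top"
    by real_asymp
  ultimately have "filterlim (\<lambda>n. core_radius (\<Lambda> n)) at_top sequentially"
    unfolding core_radius_def by (rule filterlim_compose[rotated])
  then show ?thesis
    unfolding phase_def by (intro filterlim_compose[OF filterlim_nat_sequentially] filterlim_compose[OF filterlim_floor_sequentially])
qed

text \<open>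
A block on the full box of radius \<open>R n\<close> occurs at $\sqrt{c_n}$ or more sites of a single residue
class, where the boxes are disjoint; each occurrence is one of every smaller block contained in it. The failure
probability is eventually at most $1/c_n^2 = O(1/n^2)$.
\<close>
lemma AE_eventually_many_occurrences:
  assumes \<Gamma>0: "Markov_neighborhood M X \<Gamma>0" and \<alpha>: "0 < \<alpha>"
    and lim: "(\<lambda>n. real (card (\<Lambda> n)) / real (card (core (\<Lambda> n)))) \<longlonglongrightarrow> 1"
  defines "c \<equiv> \<lambda>n. real (card (core (\<Lambda> n)))"
  defines "R \<equiv> \<lambda>n. nat \<lfloor>(\<alpha> * ln (c n)) powr (1 / (2 * real CARD('d)))\<rfloor>"
  shows "AE \<omega> in M. \<forall>\<^sub>F n in sequentially. \<forall>\<Gamma> a. \<Gamma> \<subseteq> box (R n) \<longrightarrow>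
           sqrt (c n) \<le> (\<Sum>i\<in>core (\<Lambda> n). occurs \<Gamma> a i (conf \<omega>))"
proof -
  obtain q where q_bound: "uniform_site_bound q"
    using exists_uniform_site_bound[OF \<Gamma>0] by (rule exE)
  then have q: "0 < q" "q \<le> 1"
    by (auto simp: uniform_site_bound_def)
  let ?A = "real CARD('a)" and ?d = "CARD('d)"
  let ?B = "\<lambda>n. (2 * R n + 1) ^ ?d"
  \<comment> \<open>A residue class that contains at least the average share of the core.\<close>
  define I where "I n = {i \<in> core (\<Lambda> n). residue (2 * R n + 1) i
      = (SOME k. card (core (\<Lambda> n)) \<le> ?B n * card {i \<in> core (\<Lambda> n). residue (2 * R n + 1) i = k})}" for n
  define few where "few n a = {\<omega> \<in> space M. (\<Sum>i\<in>I n. occurs (box (R n)) a i (conf \<omega>))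
      < q ^ card (box (R n) :: (int ^ 'd) set) * card (I n) / 4}" for n and a :: "int ^ 'd \<Rightarrow> 'a"
  define Few where "Few n = (\<Union>a\<in>box (R n) \<rightarrow>\<^sub>E UNIV. few n a)" for n
  have finI: "finite (core (\<Lambda> n))" "finite (I n)" if "1 \<le> n" for n
    using finite_subset[OF core_subset finite_\<Lambda>[OF that]] by (auto simp: I_def)
  have card_I: "card (core (\<Lambda> n)) \<le> ?B n * card (I n)" if "1 \<le> n" for n
  proof -
    have "\<exists>k. card (core (\<Lambda> n)) \<le> ?B n * card {i \<in> core (\<Lambda> n). residue (2 * R n + 1) i = k}"
      using exists_large_residue_class[OF finI(1)[OF that], of "2 * R n + 1"] by auto
    then show ?thesis
      unfolding I_def by (rule someI_ex)
  qed
  have disj: "translate (box (R n)) i \<inter> translate (box (R n)) j = {}" if "i \<in> I n" "j \<in> I n" "i \<noteq> j" for n i j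
    using that same_residue_boxes_meet[of "R n" i j] by (fastforce simp: translate_def I_def)
  have few: "few n a \<in> events" "prob (few n a) \<le> exp (- (q ^ ?B n * card (I n) / 4))" if "1 \<le> n" for n a
  proof -
    note occ = prob_few_occurrences_le[OF q_bound finite_box finI(2)[OF that] disj, of n a]
    show "few n a \<in> events"
      unfolding few_def by (rule occ(1))
    show "prob (few n a) \<le> exp (- (q ^ ?B n * card (I n) / 4))"
      unfolding few_def card_box[symmetric, where 'd = 'd] by (rule occ(2))
  qed
  have Few: "Few n \<in> events" if "1 \<le> n" for n
    unfolding Few_def using that by (intro sets.finite_UN finite_PiE few) auto
  have R: "real (R n) \<le> (\<alpha> * ln (c n)) powr (1 / (2 * real ?d))" for n
    by (simp add: R_def)
  have est: "\<forall>\<^sub>F n in sequentially.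
      sqrt (c n) \<le> q ^ ?B n * c n / (4 * (2 * real (R n) + 1) ^ ?d) \<and>
      ?A ^ ?B n * exp (- sqrt (c n)) \<le> 1 / (c n)\<^sup>2"
  proof -
    have "1 \<le> ?A"
      using zero_less_card_finite[where 'a = 'a] by linarith
    from eventually_occurrence_estimates[OF \<alpha> _ q this, of ?d]
    have "\<forall>\<^sub>F c in at_top. \<forall>R::nat. real R \<le> (\<alpha> * ln c) powr (1 / (2 * real ?d)) \<longrightarrow>
           sqrt c \<le> q ^ ((2 * R + 1) ^ ?d) * c / (4 * (2 * real R + 1) ^ ?d) \<and>
           ?A ^ ((2 * R + 1) ^ ?d) * exp (- sqrt c) \<le> 1 / c\<^sup>2"
      by simp
    from eventually_compose_filterlim[OF this core_card_growth(3)[OF lim]]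
    show ?thesis
    proof eventually_elim
      case (elim n)
      then show ?case
        using R[of n] unfolding c_def by blast
    qed
  qed
  have enough: "\<forall>\<^sub>F n in sequentially. sqrt (c n) \<le> q ^ ?B n * card (I n) / 4"
    using est eventually_ge_at_top[of 1]
  proof eventually_elim
    case (elim n)
    have "c n \<le> real (?B n * card (I n))"
      unfolding c_def using card_I[OF elim(2)] by (rule of_nat_mono)
    also have "\<dots> = (2 * real (R n) + 1) ^ ?d * card (I n)"
      by (simp add: add.commute)
    finally have "q ^ ?B n * c n / (4 * (2 * real (R n) + 1) ^ ?d)
        \<le> q ^ ?B n * ((2 * real (R n) + 1) ^ ?d * card (I n)) / (4 * (2 * real (R n) + 1) ^ ?d)"
      using q by (intro divide_right_mono mult_left_mono) auto
    also have "\<dots> = q ^ ?B n * card (I n) / 4"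
    proof -
      have "(2 * real (R n) + 1) ^ ?d \<noteq> 0" by simp
      then show ?thesis by (simp add: field_simps)
    qed
    finally show ?case
      using elim by linarith
  qed
  have "\<forall>\<^sub>F n in sequentially. prob (Few n) \<le> 16 * (1 / real n ^ 2)"
    using est enough core_card_growth(2)[OF lim] eventually_ge_at_top[of 1]
  proof eventually_elim
    case (elim n)
    have "prob (Few n) \<le> (\<Sum>a\<in>box (R n) \<rightarrow>\<^sub>E UNIV. prob (few n a))"
      unfolding Few_def using few(1)[OF elim(4)] by (intro finite_measure_subadditive_finite finite_PiE) auto
    also have "\<dots> \<le> (\<Sum>a\<in>(box (R n) :: (int ^ 'd) set) \<rightarrow>\<^sub>E (UNIV :: 'a set). exp (- sqrt (c n)))"
    proof (rule sum_mono)
      fix a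
      show "prob (few n a) \<le> exp (- sqrt (c n))"
        using few(2)[OF elim(4), of a] elim(2) by (meson exp_le_cancel_iff neg_le_iff_le order_trans)
    qed
    also have "\<dots> = ?A ^ ?B n * exp (- sqrt (c n))"
      by (simp add: card_PiE card_box)
    also have "\<dots> \<le> 1 / (c n)\<^sup>2"
      using elim by simp
    also have "\<dots> \<le> 1 / (real n / 4)\<^sup>2"
      using elim unfolding c_def by (intro divide_left_mono power_mono mult_pos_pos zero_less_power) auto
    also have "\<dots> = 16 * (1 / real n ^ 2)"
      by (simp add: power_divide)
    finally show ?case .
  qed
  moreover have "summable (\<lambda>n. 16 * (1 / real n ^ 2))"
    using inverse_power_summable[of 2, where 'a = real] by (intro summable_mult) (simp add: inverse_eq_divide)
  ultimately have "summable (\<lambda>n. prob (Few n))"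
    by (intro summable_comparison_test_ev[of "\<lambda>n. prob (Few n)" "\<lambda>n. 16 * (1 / real n ^ 2)"]) simp_all
  then have "summable (\<lambda>n. prob (Few (Suc n)))"
    by (rule summable_Suc_iff[of "\<lambda>n. prob (Few n)", THEN iffD2])
  then have "AE \<omega> in M. \<forall>\<^sub>F n in sequentially. \<omega> \<in> space M - Few (Suc n)"
    by (intro borel_cantelli_AE1 Few) (auto simp: emeasure_eq_measure)
  then show ?thesis
  proof eventually_elim
    case (elim \<omega>)
    then have "\<forall>\<^sub>F n in sequentially. \<omega> \<in> space M - Few n"
      by (subst (asm) eventually_sequentially_Suc)
    with enough eventually_ge_at_top[of 1] show ?case
    proof eventually_elim
      case (elim n)
      show ?case
      proof (intro allI impI)
        fix \<Gamma> :: "(int ^ 'd) set" and a :: "int ^ 'd \<Rightarrow> 'a" assume \<Gamma>: "\<Gamma> \<subseteq> box (R n)"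
        let ?a = "restrict a (box (R n))"
        have "?a \<in> box (R n) \<rightarrow>\<^sub>E UNIV"
          by simp
        then have "\<omega> \<notin> few n ?a"
          using elim(3) unfolding Few_def by blast
        then have "q ^ ?B n * card (I n) / 4 \<le> (\<Sum>i\<in>I n. occurs (box (R n)) ?a i (conf \<omega>))"
          using elim(3) unfolding few_def card_box[symmetric, where 'd = 'd] not_less[symmetric] by blast
        also have "\<dots> \<le> (\<Sum>i\<in>I n. occurs \<Gamma> a i (conf \<omega>))"
          using \<Gamma> by (intro sum_mono) (auto simp: occurs_def)
        also have "\<dots> \<le> (\<Sum>i\<in>core (\<Lambda> n). occurs \<Gamma> a i (conf \<omega>))"
          using finI[OF elim(2)] by (intro sum_mono2) (auto simp: occurs_def I_def)
        finally show "sqrt (c n) \<le> (\<Sum>i\<in>core (\<Lambda> n). occurs \<Gamma> a i (conf \<omega>))"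
          using elim(1) by linarith
      qed
    qed
  qed
qed

end

section \<open>The typicality theorem\<close>

theorem proposition3p1:
  fixes M :: "'w measure"
    and X :: "int ^ 'd::finite \<Rightarrow> 'w \<Rightarrow> 'a::finite"
    and \<Lambda> :: "nat \<Rightarrow> (int ^ 'd) set"
    and \<alpha> \<kappa> :: real
  assumes "Markov_random_field M X"
    and "positive_marginals M X"
    and "\<And>n. n \<ge> 1 \<Longrightarrow> finite (\<Lambda> n)"
    and "\<And>n. n \<ge> 1 \<Longrightarrow> \<Lambda> n \<subset> \<Lambda> (Suc n)"
    and "(\<lambda>n. real (card (\<Lambda> n)) / real (card (core (\<Lambda> n)))) \<longlonglongrightarrow> 1"
    and "0 < \<alpha>" and "\<alpha> \<le> 1"
    and "\<kappa> > 2 ^ (3 * CARD('d)) * exp 1 * \<alpha> * ln ((real CARD('a))\<^sup>2 + 1)"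
  shows "AE \<omega> in M. \<forall>\<^sub>F n in sequentially. \<forall>\<Gamma> a.
           Markov_neighborhood M X \<Gamma> \<and>
           real_of_int (radius \<Gamma>) \<le> \<alpha> powr (1 / (2 * real CARD('d)))
              * ln (real (card (core (\<Lambda> n)))) powr (1 / (2 * real CARD('d))) \<longrightarrow>
           (let N = real (count_nbhd (\<Lambda> n) (\<lambda>i. X i \<omega>) \<Gamma> a);
                N0 = real (count_nbhd_site (\<Lambda> n) (\<lambda>i. X i \<omega>) \<Gamma> a)
            in N > 0 \<and>
               \<bar>N0 / N - block_cond_prob M X {0} \<Gamma> a\<bar> < sqrt (\<kappa> * ln N / N))"
proof -
  obtain \<Gamma>0 where \<Gamma>0: "Markov_neighborhood M X \<Gamma>0" and M: "random_field M X"
    using assms(1) by (auto simp: Markov_random_field_def)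
  define level where "level = threshold (ln ((real CARD('a))\<^sup>2 + 1)) CARD('d)"
  interpret prob_space M
    using M by (simp add: random_field_def)
  interpret sampled_field M X \<Lambda> level
    using M assms(2-4) by unfold_locales (auto simp: random_field_def level_def)
  let ?d = "CARD('d)"
  have d: "1 / (2 * real ?d) \<le> 1"
  proof -
    have "1 \<le> 2 * real ?d"
      using zero_less_card_finite[where 'a = 'd] by linarith
    then show ?thesis
      by (subst divide_le_eq_1_pos) linarith+
  qed
  define b where "b = ln ((real CARD('a))\<^sup>2 + 1)"
  have b: "0 < b"
    unfolding b_def by (intro ln_gt_zero) simp
  \<comment> \<open>As $2^{3d} e = 4^d \cdot 2^d e$ and $2^d e \ge 4$, a factor of 4 is available. A factor of 2
    pays for $\ln N \ge \frac12 \ln c$, and the other one makes the final inequality strict.\<close>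
  have \<kappa>: "4 ^ ?d * \<alpha> * b < \<kappa> / 4"
  proof -
    have "(2 :: real) ^ (3 * ?d) = 4 ^ ?d * 2 ^ ?d"
      by (simp add: power_mult flip: power_mult_distrib)
    moreover have "(2 :: real) * 2 \<le> 2 ^ ?d * exp 1"
    proof (rule mult_mono)
      show "(2 :: real) \<le> 2 ^ ?d"
        using power_increasing[of 1 ?d "2 :: real"] by (simp add: Suc_leI)
      show "(2 :: real) \<le> exp 1"
        using exp_ge_add_one_self[of "1 :: real"] by simp
    qed auto
    then have "4 ^ ?d * \<alpha> * b * 4 \<le> 4 ^ ?d * \<alpha> * b * (2 ^ ?d * exp 1)"
      using assms(6) b by (intro mult_left_mono) auto
    ultimately show ?thesis
      using assms(8) by (simp add: b_def mult_ac)
  qed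
  have "0 < 4 ^ ?d * \<alpha> * b"
    using assms(6) b by simp
  with \<kappa> have \<kappa>_pos: "0 < \<kappa>" by linarith
  define c where "c n = real (card (core (\<Lambda> n)))" for n
  define R where "R n = nat \<lfloor>(\<alpha> * ln (c n)) powr (1 / (2 * real ?d))\<rfloor>" for n
  have R: "real (R n) \<le> (\<alpha> * ln (c n)) powr (1 / (2 * real ?d))" for n
    by (simp add: R_def)
  have c_top: "filterlim c at_top sequentially"
    using core_card_growth(3)[OF assms(5)] by (simp add: c_def[abs_def])
  have c1: "\<forall>\<^sub>F n in sequentially. 1 < c n"
    using c_top by (rule filterlim_at_top_dense[THEN iffD1, rule_format])
  have thr: "\<forall>\<^sub>F n in sequentially. (2 * real (R n) + 1) ^ ?d * level (phase (\<Lambda> n)) (R n) \<le> \<kappa> / 4 * ln (c n)"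
  proof -
    have "\<forall>\<^sub>F c in at_top. \<forall>R \<rho> :: nat. real R \<le> (\<alpha> * ln c) powr (1 / (2 * real ?d)) \<longrightarrow>
           real \<rho> \<le> 1 + ln (2 * c) \<longrightarrow> (2 * real R + 1) ^ ?d * threshold b ?d \<rho> R \<le> \<kappa> / 4 * ln c"
      using assms(6,7) b \<kappa> by (intro eventually_threshold_le) auto
    from eventually_compose_filterlim[OF this c_top] c1 core_card_growth(1)[OF assms(5)] eventually_ge_at_top[of 1]
    show ?thesis
    proof eventually_elim
      case (elim n)
      have card: "card (core (\<Lambda> n)) \<le> card (\<Lambda> n)"
        using elim(4) by (intro card_mono core_subset assms(3))
      then have ge1: "1 \<le> real (card (\<Lambda> n))"
        using elim(2) by (simp add: c_def)
      then have "core_radius (\<Lambda> n) \<le> 1 + ln (real (card (\<Lambda> n)))"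
        unfolding core_radius_def by (intro powr_le_one_plus d) auto
      also have "ln (real (card (\<Lambda> n))) \<le> ln (2 * c n)"
        using elim(3) ge1 by (intro ln_mono) (auto simp: c_def)
      finally have "real (phase (\<Lambda> n)) \<le> 1 + ln (2 * c n)"
        using phase_le[of "\<Lambda> n"] by linarith
      with elim(1) R show ?case
        unfolding level_def b_def by blast
    qed
  qed
  have "AE \<omega> in M. \<forall>\<^sub>F n in sequentially. \<forall>\<Gamma> a. \<Gamma> \<subseteq> box (R n) \<longrightarrow>
           sqrt (c n) \<le> (\<Sum>i\<in>core (\<Lambda> n). occurs \<Gamma> a i (conf \<omega>))"
    unfolding R_def c_def by (rule AE_eventually_many_occurrences[OF \<Gamma>0 assms(6,5)])
  with AE_eventually_not_deviating AE_space show ?thesis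
  proof eventually_elim
    case (elim \<omega>)
    from eventually_compose_filterlim[OF elim(1) phase_at_top[OF assms(5)]]
      elim(3) thr c1 eventually_ge_at_top[of 1]
    show ?case
    proof eventually_elim
      case (elim n)
      note good = elim(1) and many = elim(2) and thr = elim(3) and c1 = elim(4) and n = elim(5)
      show ?case
      proof (intro allI impI, elim conjE)
        fix \<Gamma> and a :: "int ^ 'd \<Rightarrow> 'a"
        assume \<Gamma>: "Markov_neighborhood M X \<Gamma>"
          and rad: "real_of_int (radius \<Gamma>) \<le> \<alpha> powr (1 / (2 * real ?d))
              * ln (real (card (core (\<Lambda> n)))) powr (1 / (2 * real ?d))"
        let ?N = "real (count_nbhd (\<Lambda> n) (conf \<omega>) \<Gamma> a)"
        let ?K = "real (count_nbhd_site (\<Lambda> n) (conf \<omega>) \<Gamma> a)"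
        let ?Q = "block_cond_prob M X {0} \<Gamma> a"
        have "real_of_int (radius \<Gamma>) \<le> (\<alpha> * ln (c n)) powr (1 / (2 * real ?d))"
          using rad assms(6) c1 by (simp add: c_def powr_mult)
        then have "radius \<Gamma> \<le> int (R n)"
          by (simp add: R_def le_floor_iff)
        then have box: "\<Gamma> \<subseteq> box (R n)"
          using Markov_neighborhoodD(1)[OF \<Gamma>] by (intro subset_box_if_radius_le)
        have R_phase: "R n \<le> phase (\<Lambda> n)"
        proof -
          have "c n \<le> real (card (\<Lambda> n))"
            unfolding c_def using n by (intro of_nat_mono card_mono core_subset assms(3))
          then have "\<alpha> * ln (c n) \<le> 1 * ln (real (card (\<Lambda> n)))"
            using assms(6,7) c1 by (intro mult_mono ln_mono) auto
          then have "(\<alpha> * ln (c n)) powr (1 / (2 * real ?d)) \<le> core_radius (\<Lambda> n)"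
            unfolding core_radius_def using assms(6) c1 by (intro powr_mono2) auto
          then show ?thesis
            unfolding R_def phase_def by (intro nat_mono floor_mono)
        qed
        have N_ge: "sqrt (c n) \<le> ?N"
          unfolding count_nbhd_eq_sum[OF assms(3)[OF n] box R_phase] by (rule many[rule_format, OF box])
        have "1 < sqrt (c n)"
          using c1 by simp
        with N_ge have N: "1 < ?N" by linarith
        have "ln (c n) / 2 = ln (sqrt (c n))"
          using c1 by (simp add: ln_sqrt)
        also have "\<dots> \<le> ln ?N"
          using N_ge c1 by (intro ln_mono) auto
        finally have "\<kappa> / 4 * ln (c n) \<le> \<kappa> / 2 * ln ?N"
          using \<kappa>_pos by simp
        with thr have le: "(2 * real (R n) + 1) ^ ?d * level (phase (\<Lambda> n)) (R n) \<le> \<kappa> / 2 * ln ?N"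
          by linarith
        have "(?K - ?N * ?Q)\<^sup>2 \<le> (2 * real (R n) + 1) ^ ?d * level (phase (\<Lambda> n)) (R n) * ?N"
          using N \<open>\<omega> \<in> space M\<close> good n R_phase box \<Gamma> by (intro count_deviation_square_le) auto
        also have "\<dots> \<le> \<kappa> / 2 * ln ?N * ?N"
          using le by (rule mult_right_mono) simp
        also have "\<dots> < \<kappa> * ln ?N * ?N"
          using \<kappa>_pos N by simp
        finally have less: "(?K - ?N * ?Q)\<^sup>2 < \<kappa> * ln ?N * ?N" .
        have "\<bar>?K / ?N - ?Q\<bar>\<^sup>2 = ((?K - ?N * ?Q) / ?N)\<^sup>2"
          using N by (simp add: diff_divide_distrib)
        also have "\<dots> = (?K - ?N * ?Q)\<^sup>2 / ?N\<^sup>2"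
          by (rule power_divide)
        also have "\<dots> < \<kappa> * ln ?N * ?N / ?N\<^sup>2"
          using less by (rule divide_strict_right_mono) (use N in simp)
        also have "\<dots> = \<kappa> * ln ?N / ?N"
          using N by (simp add: power2_eq_square)
        finally have "\<bar>?K / ?N - ?Q\<bar> < sqrt (\<kappa> * ln ?N / ?N)"
          by (rule real_less_rsqrt)
        with N show "let N = ?N; N0 = ?K in N > 0 \<and> \<bar>N0 / N - ?Q\<bar> < sqrt (\<kappa> * ln N / N)"
          by (simp add: Let_def)
      qed
    qed
  qed
qed

end
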